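(* Let $X$ be a shift space (subshift) over a finite alphabet, with language $\mathcal{L}=\mathcal{L}(X)$ and left shift $\sigma$, and let $\varphi:X\to\mathbb{R}$ be a continuous function. Suppose that $\mathcal{G}\subset\mathcal{L}$ has $(W)$-specification and that $\mathcal{L}$ is edit approachable by $\mathcal{G}$. Then for every continuous $\psi:X\to\mathbb{R}$, either $\hat X(\psi)=\emptyset$, or $$P_{\hat X(\psi)}(\varphi)=P_X(\varphi).$$
   Context: Shift spaces. Let $p\ge 2$, $\mathcal{A}=\{1,\dots,p\}$, and let $\mathcal{A}^{\mathbb{N}}$ be the space of one-sided sequences $(w_i)_{i\ge1}$ with the product topology, with left shift $\sigma((w_i)_{i\ge1})=(w_{i+1})_{i\ge1}$. A shift space is a non-empty compact $X\subset\mathcal{A}^{\mathbb{N}}$ with $\sigma(X)\subset X$. Let $\mathcal{A}^*=\bigcup_{n\ge0}\mathcal{A}^n$ be the set of finite words, $|w|$ the length of $w$, and $[w]$ the set of sequences beginning with $w$. The language is $\mathcal{L}(X)=\{w\in\mathcal{A}^*:[w]\cap X\ne\emptyset\}$. Juxtaposition of words denotes concatenation. $(W)$-specification. $\mathcal{G}\subset\mathcal{L}$ has $(W)$-specification if there is $\tau\in\mathbb{N}$ such that for all $v,w\in\mathcal{G}$ there is $u\in\mathcal{L}$ with $|u|\le\tau$ and $vuw\in\mathcal{G}$. Edit approachability. An edit of a word is one of: substitution $u^1au^2\mapsto u^1a'u^2$; insertion $u^1u^2\mapsto u^1a'u^2$; deletion $u^1au^2\mapsto u^1u^2$, where $u^1,u^2$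 are arbitrary (possibly empty) words and $a,a'\in\mathcal{A}$. For words $v,w$, $\hat d(v,w)$ is the minimum number of edits needed to transform $v$ into $w$. A mistake function is a non-decreasing $g:\{0,1,2,\dots\}\to\{0,1,2,\dots\}$ with $g(n)/n\to0$. $\mathcal{L}$ is edit approachable by $\mathcal{G}$ if there is a mistake function $g$ such that for every $w\in\mathcal{L}$ there is $v\in\mathcal{G}$ with $\hat d(v,w)\le g(|w|)$. Irregular set. With $S_n\psi(x)=\sum_{i=0}^{n-1}\psi(\sigma^ix)$, put $\hat X(\psi)=\{x\in X:\lim_{n\to\infty}\frac{S_n\psi(x)}{n}\text{ does not exist}\}$. Topological pressure. For Borel $Z\subset X$, $t\in\mathbb{R}$, $N\in\mathbb{N}$, let $$M(Z,t,\varphi,N)=\inf_{\mathcal{S}}\sum_{[w_0\cdots w_m]\in\mathcal{S}}\exp\Big(-t(m+1)+\sup_{x\in[w_0\cdots w_m]\cap X}\sum_{k=0}^m\varphi(\sigma^kx)\Big),$$ the infimum over finite or countable collections $\mathcal{S}$ of cylinders $[w_0\cdots w_m]$ (of words in $\mathcal{L}$) with $m\ge N$ that cover $Z$. Let $M(Z,t,\varphi)=\lim_{N\to\infty}M(Z,t,\varphi,N)$ and $P_Z(\varphi)=\inf\{t:M(Z,t,\varphi)=0\}$. *)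

theory Defs
  imports "HOL-Analysis.Analysis"
begin

text \<open>Sequences are functions on \<^typ>\<open>nat\<close>, so the coordinate \<open>w\<^sub>1\<close> of \<open>(w\<^sub>i)\<^sub>i\<^sub>\<ge>\<^sub>1\<close> is
  \<open>w 0\<close>.  The type \<^typ>\<open>nat \<Rightarrow> nat\<close> carries the product topology of the discrete
  topology on \<^typ>\<open>nat\<close>; the topology it induces on \<open>full_shift p\<close> is the product topology
  of the finite discrete alphabet.\<close>

definition alphabet :: "nat \<Rightarrow> nat set" where
  "alphabet p = {1..p}"

definition full_shift :: "nat \<Rightarrow> (nat \<Rightarrow> nat) set" where
  "full_shift p = {x. \<forall>i. x i \<in> alphabet p}"

definition shift :: "(nat \<Rightarrow> nat) \<Rightarrow> (nat \<Rightarrow> nat)" where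
  "shift x = (\<lambda>i. x (Suc i))"

definition shift_space :: "nat \<Rightarrow> (nat \<Rightarrow> nat) set \<Rightarrow> bool" where
  "shift_space p X \<longleftrightarrow> X \<noteq> {} \<and> X \<subseteq> full_shift p \<and> compact X \<and> shift ` X \<subseteq> X"

text \<open>The alphabet need not be mentioned in the next two definitions: cylinders are only
  ever intersected with, or used to cover, subsets of \<open>full_shift p\<close>, and
  \<open>X \<subseteq> full_shift p\<close> forces every word of \<open>language X\<close> to be a word over the alphabet.\<close>

definition cylinder :: "nat list \<Rightarrow> (nat \<Rightarrow> nat) set" where
  "cylinder w = {x. \<forall>i<length w. x i = w ! i}"

definition language :: "(nat \<Rightarrow> nat) set \<Rightarrow> nat list set" where
  "language X = {w. cylinder w \<inter> X \<noteq> {}}"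

definition W_specification :: "nat list set \<Rightarrow> nat list set \<Rightarrow> bool" where
  "W_specification L G \<longleftrightarrow>
     (\<exists>\<tau>::nat. \<forall>v\<in>G. \<forall>w\<in>G. \<exists>u\<in>L. length u \<le> \<tau> \<and> v @ u @ w \<in> G)"

inductive_set edit :: "nat \<Rightarrow> (nat list \<times> nat list) set" for p :: nat where
  substitution: "u1 \<in> lists (alphabet p) \<Longrightarrow> u2 \<in> lists (alphabet p) \<Longrightarrow>
      a \<in> alphabet p \<Longrightarrow> a' \<in> alphabet p \<Longrightarrow> (u1 @ [a] @ u2, u1 @ [a'] @ u2) \<in> edit p"
| insertion: "u1 \<in> lists (alphabet p) \<Longrightarrow> u2 \<in> lists (alphabet p) \<Longrightarrow>
      a' \<in> alphabet p \<Longrightarrow> (u1 @ u2, u1 @ [a'] @ u2) \<in> edit p"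
| deletion: "u1 \<in> lists (alphabet p) \<Longrightarrow> u2 \<in> lists (alphabet p) \<Longrightarrow>
      a \<in> alphabet p \<Longrightarrow> (u1 @ [a] @ u2, u1 @ u2) \<in> edit p"

definition edit_distance :: "nat \<Rightarrow> nat list \<Rightarrow> nat list \<Rightarrow> nat" where
  "edit_distance p v w = (LEAST n. (v, w) \<in> edit p ^^ n)"

text \<open>The minimum is over a nonempty set whenever both words are over the alphabet.\<close>

lemma edit_distance_attained:
  assumes "v \<in> lists (alphabet p)" "w \<in> lists (alphabet p)"
  shows "(v, w) \<in> edit p ^^ edit_distance p v w"
proof -
  have "(v, []) \<in> (edit p)\<^sup>*" using assms(1)
  proof (induction v)
    case (Cons a v)
    have "(a # v, v) \<in> edit p"
      using edit.deletion[of "[]" p v a] Cons.hyps by auto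
    then show ?case using Cons.IH by (rule converse_rtrancl_into_rtrancl)
  qed simp
  moreover have "([], w) \<in> (edit p)\<^sup>*" using assms(2)
  proof (induction w)
    case (Cons a w)
    have "(w, a # w) \<in> edit p"
      using edit.insertion[of "[]" p w a] Cons.hyps by auto
    then show ?case using Cons.IH by (meson rtrancl.rtrancl_into_rtrancl)
  qed simp
  ultimately have "(v, w) \<in> (edit p)\<^sup>*" by (rule rtrancl_trans)
  then obtain n where "(v, w) \<in> edit p ^^ n" by (auto simp: rtrancl_power)
  then show ?thesis unfolding edit_distance_def by (rule LeastI)
qed

definition mistake_function :: "(nat \<Rightarrow> nat) \<Rightarrow> bool" where
  "mistake_function g \<longleftrightarrow> mono g \<and> (\<lambda>n. real (g n) / real n) \<longlonglongrightarrow> 0"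

definition edit_approachable :: "nat \<Rightarrow> nat list set \<Rightarrow> nat list set \<Rightarrow> bool" where
  "edit_approachable p L G \<longleftrightarrow>
     (\<exists>g. mistake_function g \<and> (\<forall>w\<in>L. \<exists>v\<in>G. edit_distance p v w \<le> g (length w)))"

definition birkhoff_sum :: "((nat \<Rightarrow> nat) \<Rightarrow> real) \<Rightarrow> nat \<Rightarrow> (nat \<Rightarrow> nat) \<Rightarrow> real" where
  "birkhoff_sum \<psi> n x = (\<Sum>i<n. \<psi> ((shift ^^ i) x))"

definition irregular_set ::
    "(nat \<Rightarrow> nat) set \<Rightarrow> ((nat \<Rightarrow> nat) \<Rightarrow> real) \<Rightarrow> (nat \<Rightarrow> nat) set" where
  "irregular_set X \<psi> = {x \<in> X. \<not> convergent (\<lambda>n. birkhoff_sum \<psi> n x / real n)}"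

text \<open>A collection of cylinders \<open>[w\<^sub>0 \<dots> w\<^sub>m]\<close> is given by its set \<open>C\<close> of defining words, with
  \<open>length w = m + 1\<close>, so \<open>m \<ge> N\<close> becomes \<open>length w > N\<close>.  For words over an alphabet with at
  least two letters, distinct words have distinct cylinders.\<close>

definition cylinder_covers ::
    "(nat \<Rightarrow> nat) set \<Rightarrow> (nat \<Rightarrow> nat) set \<Rightarrow> nat \<Rightarrow> nat list set set" where
  "cylinder_covers X Z N =
     {C. countable C \<and> C \<subseteq> language X \<and> (\<forall>w\<in>C. length w > N) \<and> Z \<subseteq> (\<Union>w\<in>C. cylinder w)}"

definition pressure_sum_N ::
    "(nat \<Rightarrow> nat) set \<Rightarrow> (nat \<Rightarrow> nat) set \<Rightarrow> real \<Rightarrow> ((nat \<Rightarrow> nat) \<Rightarrow> real) \<Rightarrow> nat \<Rightarrow> ennreal" where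
  "pressure_sum_N X Z t \<phi> N =
     (INF C\<in>cylinder_covers X Z N.
        \<Sum>\<^sub>\<infinity>w\<in>C. ennreal (exp (- t * real (length w)
                     + (SUP x\<in>cylinder w \<inter> X. birkhoff_sum \<phi> (length w) x))))"

definition pressure_sum ::
    "(nat \<Rightarrow> nat) set \<Rightarrow> (nat \<Rightarrow> nat) set \<Rightarrow> real \<Rightarrow> ((nat \<Rightarrow> nat) \<Rightarrow> real) \<Rightarrow> ennreal" where
  "pressure_sum X Z t \<phi> = lim (\<lambda>N. pressure_sum_N X Z t \<phi> N)"

text \<open>The limit always exists, by monotonicity in \<open>N\<close>.\<close>

lemma pressure_sum_N_tendsto:
  "(\<lambda>N. pressure_sum_N X Z t \<phi> N) \<longlonglongrightarrow> pressure_sum X Z t \<phi>"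
proof -
  have "incseq (\<lambda>N. pressure_sum_N X Z t \<phi> N)"
    unfolding pressure_sum_N_def cylinder_covers_def
    by (intro incseq_SucI INF_superset_mono) auto
  then have "convergent (\<lambda>N. pressure_sum_N X Z t \<phi> N)"
    using LIMSEQ_SUP convergentI by blast
  then show ?thesis
    unfolding pressure_sum_def by (simp add: convergent_LIMSEQ_iff)
qed

definition pressure ::
    "(nat \<Rightarrow> nat) set \<Rightarrow> (nat \<Rightarrow> nat) set \<Rightarrow> ((nat \<Rightarrow> nat) \<Rightarrow> real) \<Rightarrow> ereal" where
  "pressure X Z \<phi> = Inf {ereal t | t. pressure_sum X Z t \<phi> = 0}"

end

(*
  The points of the irregular set that avoid a given cover are built by concatenating words of G.
  If the pressure sum of X at t' is positive, then the words of length n in the language carry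
  total weight about exp (t' n); edit approachability moves them into G, where a pigeonhole
  argument leaves a set W of words of one length m, with nearly the same average of psi, and total
  weight at least exp ((t' - theta) m).  An irregular point provides filler words v of length about
  delta m whose psi-average is bounded away from that of W.  Gluing words of W, and inserting v at
  the steps i with 4^k <= i < 2 * 4^k, makes the Birkhoff averages oscillate.  Assign to a prefix P
  the weighted mass of the cover elements extending P.  The freedom in the choice from W
  outweighs the unknown gap lengths, so the mean mass over the choices does not exceed the
  mass of P, and some choice keeps the mass below 1.  Since short extensions have mass at least 1,
  the limit point is in no cover element.
*)
theory Submission
  imports Defs "HOL-Library.Sublist" "HOL-Real_Asymp.Real_Asymp"
begin

section \<open>Words and points\<close>

text \<open>The gluing words have bounded but otherwise unknown length and depend on the whole word
  built so far. Hence the glued words are no free concatenations, and the extensions of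
  \<open>P\<close> by different words of \<open>W\<close> may be prefixes of one another. No measure
  is built on them: every choice is made with the cover already known, and the ambiguity costs a
  factor of at most \<open>2 * \<tau> + 1\<close> per step, which is absorbed by taking the words of
  \<open>W\<close> long. Continuity of \<phi> gives no bounded distortion. Birkhoff sums are
  therefore replaced by window sums on arbitrary words, additive up to a constant; the remaining
  error is linear in the length with a small slope and is paid for by the gap between
  \<open>t\<close> and \<open>t'\<close>. A filler offers no choice, so each of its letters costs up
  to \<open>\<bar>t\<bar> + B\<close> in the exponent, and only a small proportion \<delta> is
  affordable. Its influence on the average of \<psi> is then of order \<delta> as well, so the
  precision for \<psi> is fixed after \<delta>. The insertion periods grow geometrically because
  only a period comparable to the whole past can move the average.\<close>

lemma shift_funpow: "(shift ^^ k) x = (\<lambda>i. x (i + k))"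
  by (induction k) (auto simp: shift_def)

lemma birkhoff_sum_add:
  "birkhoff_sum f (m + n) x = birkhoff_sum f m x + birkhoff_sum f n ((shift ^^ m) x)"
proof (induction n)
  case 0
  show ?case by (simp add: birkhoff_sum_def)
next
  case (Suc n)
  then show ?case
    by (simp add: birkhoff_sum_def shift_funpow algebra_simps)
qed

lemma shift_space_funpow:
  assumes "shift_space p X" "x \<in> X"
  shows "(shift ^^ k) x \<in> X"
  using assms by (induction k) (auto simp: shift_space_def)

lemma cylinder_map_upt: "x \<in> cylinder (map x [0..<n])"
  by (simp add: cylinder_def)

lemma cylinder_eq_map_upt: "x \<in> cylinder w \<Longrightarrow> w = map x [0..<length w]"
  by (auto simp: cylinder_def intro!: nth_equalityI)

lemma language_map_upt: "x \<in> X \<Longrightarrow> map x [0..<n] \<in> language X"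
  using cylinder_map_upt unfolding language_def by blast

lemma drop_in_cylinder: "x \<in> cylinder w \<Longrightarrow> (shift ^^ i) x \<in> cylinder (drop i w)"
  by (auto simp: cylinder_def shift_funpow add.commute)

lemma take_in_cylinder: "x \<in> cylinder w \<Longrightarrow> x \<in> cylinder (take k w)"
  by (auto simp: cylinder_def)

lemma language_lists:
  assumes "shift_space p X"
  shows "language X \<subseteq> lists (alphabet p)"
proof
  fix w assume "w \<in> language X"
  then obtain x where x: "x \<in> cylinder w" "x \<in> X" by (auto simp: language_def)
  have "x i \<in> alphabet p" for i
    using assms x(2) by (auto simp: shift_space_def full_shift_def)
  then have "set (map x [0..<length w]) \<subseteq> alphabet p" by auto
  then show "w \<in> lists (alphabet p)"
    by (subst cylinder_eq_map_upt[OF x(1)]) auto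
qed

lemma finite_language_length:
  assumes "shift_space p X"
  shows "finite {w \<in> language X. length w = n}"
proof -
  have "finite {w. set w \<subseteq> alphabet p \<and> length w = n}"
    by (intro finite_lists_length_eq) (simp add: alphabet_def)
  then show ?thesis
    by (rule finite_subset[rotated]) (use language_lists[OF assms] in auto)
qed

lemma open_contains_cylinder:
  fixes U :: "(nat \<Rightarrow> nat) set"
  assumes "open U" "x \<in> U"
  obtains L where "cylinder (map x [0..<L]) \<subseteq> U"
proof -
  obtain V where V: "x \<in> (\<Pi>\<^sub>E i\<in>UNIV. V i)" "finite {i. V i \<noteq> UNIV}" "(\<Pi>\<^sub>E i\<in>UNIV. V i) \<subseteq> U"
    using product_topology_open_contains_basis[of "\<lambda>_. euclidean" UNIV U x] assms
    by (auto simp: open_fun_def)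
  obtain L where L: "{i. V i \<noteq> UNIV} \<subseteq> {..<L}"
    using V(2) finite_nat_iff_bounded by blast
  have "y \<in> (\<Pi>\<^sub>E i\<in>UNIV. V i)" if y: "y \<in> cylinder (map x [0..<L])" for y
  proof -
    have "y i \<in> V i" for i
    proof (cases "i < L")
      case True
      then have "y i = x i" using y by (simp add: cylinder_def)
      with V(1) show ?thesis by (auto simp: PiE_def Pi_def)
    next
      case False
      then have "V i = UNIV" using L by auto
      then show ?thesis by simp
    qed
    then show ?thesis by auto
  qed
  with V(3) have "cylinder (map x [0..<L]) \<subseteq> U" by blast
  then show ?thesis by (rule that)
qed

lemma open_cylinder: "open (cylinder w)"
proof -
  have "cylinder w = (\<Inter>i\<in>{..<length w}. (\<lambda>x. x i) -` {w ! i})"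
    by (auto simp: cylinder_def)
  also have "open \<dots>"
    by (intro open_INT ballI open_vimage continuous_on_product_coordinates) (auto simp: open_discrete)
  finally show ?thesis .
qed

text \<open>If \<open>x\<close> were outside \<open>X\<close>, the open sets of points differing
  from \<open>x\<close> in one given coordinate would cover \<open>X\<close>. A finite subcover
  involves only coordinates below some \<open>L\<close>, so no point of \<open>X\<close> would share
  the first \<open>L\<close> letters of \<open>x\<close>.\<close>

lemma mem_shift_space_limit:
  assumes "shift_space p X" and prefixes: "\<And>n. map x [0..<n] \<in> language X"
  shows "x \<in> X"
proof (rule ccontr)
  assume "x \<notin> X"
  have "compact X" using assms by (simp add: shift_space_def)
  moreover have "open {y :: nat \<Rightarrow> nat. y i \<noteq> x i}" for i
  proof -
    have "{y :: nat \<Rightarrow> nat. y i \<noteq> x i} = (\<lambda>y. y i) -` (- {x i})" by auto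
    also have "open \<dots>"
      by (intro open_vimage continuous_on_product_coordinates) (auto simp: open_discrete)
    finally show ?thesis .
  qed
  moreover have "X \<subseteq> (\<Union>i\<in>UNIV. {y. y i \<noteq> x i})"
  proof
    fix y assume "y \<in> X"
    with \<open>x \<notin> X\<close> have "y \<noteq> x" by auto
    then show "y \<in> (\<Union>i\<in>UNIV. {y. y i \<noteq> x i})" by auto
  qed
  ultimately obtain I where I: "finite I" "X \<subseteq> (\<Union>i\<in>I. {y. y i \<noteq> x i})"
    by (rule compactE_image) auto
  obtain L where "I \<subseteq> {..<L}" using I(1) finite_nat_iff_bounded by blast
  with I(2) prefixes[of L] show False by (fastforce simp: language_def cylinder_def)
qed

text \<open>A Lebesgue number argument with cylinders as balls: finitely many of them cover
  \<open>X\<close>, \<open>L\<close> is their greatest length, and both points are compared with the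
  centre of one cylinder at cost \<open>\<epsilon> / 2\<close> each.\<close>

lemma uniformly_continuous_cylinder:
  fixes f :: "(nat \<Rightarrow> nat) \<Rightarrow> real"
  assumes X: "shift_space p X" and cont: "continuous_on X f" and "\<epsilon> > 0"
  obtains L where "\<And>x y. x \<in> X \<Longrightarrow> y \<in> X \<Longrightarrow> \<forall>i<L. x i = y i \<Longrightarrow> \<bar>f x - f y\<bar> \<le> \<epsilon>"
proof -
  have "\<exists>l. \<forall>y\<in>cylinder (map x [0..<l]) \<inter> X. \<bar>f y - f x\<bar> < \<epsilon> / 2" if x: "x \<in> X" for x
  proof -
    obtain U where U: "open U" "x \<in> U" "\<forall>y\<in>X. y \<in> U \<longrightarrow> f y \<in> ball (f x) (\<epsilon> / 2)"
      using cont[unfolded continuous_on_topological, rule_format, OF x, of "ball (f x) (\<epsilon> / 2)"]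
        \<open>\<epsilon> > 0\<close> by auto
    obtain l where "cylinder (map x [0..<l]) \<subseteq> U"
      using open_contains_cylinder[OF U(1,2)] .
    with U(3) show ?thesis by (fastforce simp: dist_real_def abs_minus_commute)
  qed
  then obtain l where l: "\<And>x y. x \<in> X \<Longrightarrow> y \<in> cylinder (map x [0..<l x]) \<Longrightarrow> y \<in> X \<Longrightarrow>
      \<bar>f y - f x\<bar> < \<epsilon> / 2"
    by (metis IntI)
  have "compact X" using X by (simp add: shift_space_def)
  moreover have "X \<subseteq> (\<Union>x\<in>X. cylinder (map x [0..<l x]))"
    using cylinder_map_upt by blast
  ultimately obtain Y where Y: "Y \<subseteq> X" "finite Y" "X \<subseteq> (\<Union>x\<in>Y. cylinder (map x [0..<l x]))"
    using compactE_image[of X X "\<lambda>x. cylinder (map x [0..<l x])"] open_cylinder by metis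
  define L where "L = Max (insert 0 (l ` Y))"
  have lL: "l z \<le> L" if "z \<in> Y" for z using that Y(2) by (simp add: L_def)
  have "\<bar>f x - f y\<bar> \<le> \<epsilon>" if "x \<in> X" "y \<in> X" and agree: "\<forall>i<L. x i = y i" for x y
  proof -
    obtain z where z: "z \<in> Y" "x \<in> cylinder (map z [0..<l z])" using Y(3) \<open>x \<in> X\<close> by blast
    then have "y \<in> cylinder (map z [0..<l z])"
      using agree lL[OF z(1)] by (auto simp: cylinder_def)
    then have "\<bar>f x - f z\<bar> < \<epsilon> / 2" "\<bar>f y - f z\<bar> < \<epsilon> / 2"
      using l[of z x] l[of z y] z Y(1) that by auto
    then show ?thesis by linarith
  qed
  then show ?thesis by (rule that)
qed

section \<open>Quasi-additive functionals on words\<close>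

text \<open>The functional lives on all words, not only on the language, because a chain of edits
  may leave the language on its way. The defect \<open>C\<close> does not grow with the words, which
  Birkhoff sums of a merely continuous function do not provide.\<close>

definition quasi_additive :: "real \<Rightarrow> real \<Rightarrow> ('a list \<Rightarrow> real) \<Rightarrow> bool" where
  "quasi_additive C B \<Phi> \<longleftrightarrow> C \<ge> 0 \<and> B \<ge> 0 \<and>
     (\<forall>u v. \<bar>\<Phi> (u @ v) - \<Phi> u - \<Phi> v\<bar> \<le> C) \<and> (\<forall>w. \<bar>\<Phi> w\<bar> \<le> B * real (length w))"

lemma quasi_additive_append:
  "quasi_additive C B \<Phi> \<Longrightarrow> \<bar>\<Phi> (u @ v) - \<Phi> u - \<Phi> v\<bar> \<le> C"
  by (simp add: quasi_additive_def)

lemma quasi_additive_bound: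
  "quasi_additive C B \<Phi> \<Longrightarrow> \<bar>\<Phi> w\<bar> \<le> B * real (length w)"
  by (simp add: quasi_additive_def)

lemma quasi_additive_nonneg:
  "quasi_additive C B \<Phi> \<Longrightarrow> C \<ge> 0" "quasi_additive C B \<Phi> \<Longrightarrow> B \<ge> 0"
  by (simp_all add: quasi_additive_def)

lemma quasi_additive_uminus:
  assumes "quasi_additive C B \<Phi>"
  shows "quasi_additive C B (\<lambda>w. - \<Phi> w)"
proof -
  have "\<bar>- \<Phi> (u @ v) - - \<Phi> u - - \<Phi> v\<bar> \<le> C" for u v
    using quasi_additive_append[OF assms, of u v] by linarith
  then show ?thesis using assms by (simp add: quasi_additive_def)
qed

text \<open>Appending \<open>v\<close> alters the window at a position of \<open>u\<close> only if
  fewer than \<open>L\<close> letters of \<open>u\<close> remain there. There are at most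
  \<open>L\<close> such positions, and each changes by at most \<open>B\<close> because
  \<open>F\<close> vanishes on words shorter than \<open>L\<close>.\<close>

lemma quasi_additive_window:
  fixes F :: "'a list \<Rightarrow> real"
  assumes "B \<ge> 0" and bound: "\<And>w. \<bar>F w\<bar> \<le> B"
    and window: "\<And>w v. L \<le> length w \<Longrightarrow> F (w @ v) = F w"
    and short: "\<And>w. length w < L \<Longrightarrow> F w = 0"
  shows "quasi_additive (B * real L) B (\<lambda>w. \<Sum>i<length w. F (drop i w))"
proof -
  have card: "card {i. i < n \<and> n - i < L} \<le> L" for n
  proof -
    have "{i. i < n \<and> n - i < L} \<subseteq> {n - L..<n}" by auto
    then have "card {i. i < n \<and> n - i < L} \<le> card {n - L..<n}" by (intro card_mono) auto
    then show ?thesis by simp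
  qed
  have "\<bar>(\<Sum>i<length (u @ v). F (drop i (u @ v))) - (\<Sum>i<length u. F (drop i u))
          - (\<Sum>i<length v. F (drop i v))\<bar> \<le> B * real L" for u v
  proof -
    have split: "{..<length (u @ v)} = {..<length u} \<union> {length u..<length u + length v}" by auto
    have "(\<Sum>i<length (u @ v). F (drop i (u @ v)))
        = (\<Sum>i<length u. F (drop i (u @ v))) + (\<Sum>i=length u..<length u + length v. F (drop i (u @ v)))"
      unfolding split by (intro sum.union_disjoint) auto
    also have "(\<Sum>i=length u..<length u + length v. F (drop i (u @ v))) = (\<Sum>i<length v. F (drop i v))"
      using sum.shift_bounds_nat_ivl[of "\<lambda>i. F (drop i (u @ v))" 0 "length u" "length v"]
      by (simp add: add.commute atLeast0LessThan)
    finally have "\<bar>(\<Sum>i<length (u @ v). F (drop i (u @ v))) - (\<Sum>i<length u. F (drop i u))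
          - (\<Sum>i<length v. F (drop i v))\<bar> = \<bar>\<Sum>i<length u. F (drop i (u @ v)) - F (drop i u)\<bar>"
      by (simp add: sum_subtractf)
    also have "\<dots> \<le> (\<Sum>i<length u. \<bar>F (drop i (u @ v)) - F (drop i u)\<bar>)" by (rule sum_abs)
    also have "\<dots> \<le> (\<Sum>i<length u. if length u - i < L then B else 0)"
    proof (intro sum_mono)
      fix i assume "i \<in> {..<length u}"
      then have eq: "drop i (u @ v) = drop i u @ v" by simp
      show "\<bar>F (drop i (u @ v)) - F (drop i u)\<bar> \<le> (if length u - i < L then B else 0)"
        unfolding eq using window[of "drop i u" v] short[of "drop i u"] bound[of "drop i u @ v"]
        by (cases "length u - i < L") auto
    qed
    also have "\<dots> = B * real (card {i. i < length u \<and> length u - i < L})"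
      by (simp add: sum.If_cases Int_def lessThan_def)
    also have "\<dots> \<le> B * real L" using card assms(1) by (intro mult_left_mono) auto
    finally show ?thesis .
  qed
  moreover have "\<bar>\<Sum>i<length w. F (drop i w)\<bar> \<le> B * real (length w)" for w
  proof -
    have "\<bar>\<Sum>i<length w. F (drop i w)\<bar> \<le> (\<Sum>i<length w. B)"
      by (intro order_trans[OF sum_abs] sum_mono bound)
    then show ?thesis by (simp add: mult.commute)
  qed
  ultimately show ?thesis using assms(1) by (simp add: quasi_additive_def)
qed

text \<open>The slope \<epsilon> is the price of mere continuity; the constant \<open>C\<close>
  accounts for the positions near the end of the word, where the window is incomplete.\<close>

definition approximates_birkhoff ::
    "(nat \<Rightarrow> nat) set \<Rightarrow> ((nat \<Rightarrow> nat) \<Rightarrow> real) \<Rightarrow> real \<Rightarrow> real \<Rightarrow> (nat list \<Rightarrow> real) \<Rightarrow> bool" where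
  "approximates_birkhoff X f \<epsilon> C \<Phi> \<longleftrightarrow>
     (\<forall>w. \<forall>x\<in>cylinder w \<inter> X. \<bar>birkhoff_sum f (length w) x - \<Phi> w\<bar> \<le> \<epsilon> * real (length w) + C)"

lemma approximates_birkhoffD:
  "approximates_birkhoff X f \<epsilon> C \<Phi> \<Longrightarrow> x \<in> cylinder w \<Longrightarrow> x \<in> X \<Longrightarrow>
     \<bar>birkhoff_sum f (length w) x - \<Phi> w\<bar> \<le> \<epsilon> * real (length w) + C"
  by (auto simp: approximates_birkhoff_def)

lemma birkhoff_sum_uminus: "birkhoff_sum (\<lambda>x. - f x) n x = - birkhoff_sum f n x"
  by (simp add: birkhoff_sum_def sum_negf)

lemma approximates_birkhoff_uminus:
  assumes "approximates_birkhoff X f \<epsilon> C \<Phi>"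
  shows "approximates_birkhoff X (\<lambda>x. - f x) \<epsilon> C (\<lambda>w. - \<Phi> w)"
  unfolding approximates_birkhoff_def
proof (intro allI ballI)
  fix w x assume "x \<in> cylinder w \<inter> X"
  then show "\<bar>birkhoff_sum (\<lambda>x. - f x) (length w) x - - \<Phi> w\<bar> \<le> \<epsilon> * real (length w) + C"
    using approximates_birkhoffD[OF assms, of x w] by (simp add: birkhoff_sum_uminus)
qed

lemma shift_space_bounded:
  assumes "shift_space p X" "continuous_on X f"
  obtains B :: real where "B \<ge> 0" "\<forall>x\<in>X. \<bar>f x\<bar> \<le> B"
proof -
  have "bounded (f ` X)"
    using assms by (intro compact_imp_bounded compact_continuous_image) (auto simp: shift_space_def)
  then obtain B where "\<And>x. x \<in> X \<Longrightarrow> \<bar>f x\<bar> \<le> B"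
    by (auto simp: bounded_iff)
  then show ?thesis using that[of "max B 0"] by (simp add: le_max_iff_disj)
qed

text \<open>The function is frozen at one chosen point of each cylinder of length \<open>L\<close>,
  with \<open>L\<close> from uniform continuity. Full windows then err by at most \<epsilon>, and
  each of the last positions, where the window sum uses the default 0, by at most
  \<open>B\<close>.\<close>

lemma ex_quasi_additive_approximation:
  assumes X: "shift_space p X" and cont: "continuous_on X f" and "\<epsilon> > 0"
  obtains C B \<Phi> where "quasi_additive C B \<Phi>" "approximates_birkhoff X f \<epsilon> C \<Phi>"
proof -
  obtain B where "B \<ge> 0" and B: "\<forall>x\<in>X. \<bar>f x\<bar> \<le> B"
    using shift_space_bounded[OF X cont] .
  obtain L where L: "\<And>x y. x \<in> X \<Longrightarrow> y \<in> X \<Longrightarrow> \<forall>i<L. x i = y i \<Longrightarrow> \<bar>f x - f y\<bar> \<le> \<epsilon>"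
    using uniformly_continuous_cylinder[OF X cont \<open>\<epsilon> > 0\<close>] by metis
  define F where "F w = (if L \<le> length w \<and> take L w \<in> language X
      then f (SOME x. x \<in> cylinder (take L w) \<inter> X) else 0)" for w
  have some: "(SOME x. x \<in> cylinder w \<inter> X) \<in> cylinder w \<inter> X" if "w \<in> language X" for w
    using that unfolding language_def some_in_eq by simp
  have FB: "\<bar>F w\<bar> \<le> B" for w
    using some[of "take L w"] B \<open>B \<ge> 0\<close> by (auto simp: F_def)
  define \<Phi> where "\<Phi> w = (\<Sum>i<length w. F (drop i w))" for w
  have qa: "quasi_additive (B * real L) B \<Phi>"
    unfolding \<Phi>_def by (rule quasi_additive_window[OF \<open>B \<ge> 0\<close> FB]) (auto simp: F_def)
  have "\<bar>birkhoff_sum f (length w) x - \<Phi> w\<bar> \<le> \<epsilon> * real (length w) + B * real L"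
    if x: "x \<in> cylinder w" "x \<in> X" for w x
  proof -
    have "\<bar>birkhoff_sum f (length w) x - \<Phi> w\<bar> = \<bar>\<Sum>i<length w. f ((shift ^^ i) x) - F (drop i w)\<bar>"
      by (simp add: birkhoff_sum_def \<Phi>_def sum_subtractf)
    also have "\<dots> \<le> (\<Sum>i<length w. \<bar>f ((shift ^^ i) x) - F (drop i w)\<bar>)" by (rule sum_abs)
    also have "\<dots> \<le> (\<Sum>i<length w. \<epsilon> + (if i \<in> {length w - L..<length w} then B else 0))"
    proof (intro sum_mono)
      fix i assume "i \<in> {..<length w}"
      then have i: "i < length w" by simp
      let ?y = "(shift ^^ i) x" and ?w = "take L (drop i w)"
      have y: "?y \<in> X" "?y \<in> cylinder ?w"
        using x X by (auto intro!: shift_space_funpow take_in_cylinder drop_in_cylinder)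
      show "\<bar>f ?y - F (drop i w)\<bar> \<le> \<epsilon> + (if i \<in> {length w - L..<length w} then B else 0)"
      proof (cases "L \<le> length (drop i w)")
        case True
        have lang: "?w \<in> language X" using y by (auto simp: language_def)
        define z where "z = (SOME x. x \<in> cylinder ?w \<inter> X)"
        have z: "z \<in> cylinder ?w" "z \<in> X" using some[OF lang] unfolding z_def by blast+
        have "\<bar>f ?y - f z\<bar> \<le> \<epsilon>"
          using y z True by (intro L) (auto simp: cylinder_def)
        moreover have "F (drop i w) = f z" using True lang by (simp add: F_def z_def)
        ultimately show ?thesis using \<open>B \<ge> 0\<close> by auto
      next
        case False
        then have "F (drop i w) = 0" "i \<in> {length w - L..<length w}" using i by (auto simp: F_def)
        then show ?thesis using bspec[OF B y(1)] \<open>\<epsilon> > 0\<close> by simp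
      qed
    qed
    also have "\<dots> = \<epsilon> * real (length w) + B * real (card ({..<length w} \<inter> {length w - L..<length w}))"
      by (simp add: sum.distrib sum.If_cases mult.commute del: atLeastLessThan_iff)
    also have "\<dots> \<le> \<epsilon> * real (length w) + B * real L"
    proof -
      have "card ({..<length w} \<inter> {length w - L..<length w}) \<le> card {length w - L..<length w}"
        by (intro card_mono) auto
      then show ?thesis using \<open>B \<ge> 0\<close> by (intro add_left_mono mult_left_mono) auto
    qed
    finally show ?thesis .
  qed
  then have "approximates_birkhoff X f \<epsilon> (B * real L) \<Phi>"
    by (auto simp: approximates_birkhoff_def)
  with qa show ?thesis by (rule that)
qed

section \<open>Edits\<close>

lemma edit_cases:
  assumes "(v, w) \<in> edit p"
  obtains u1 u2 m m' where "v = u1 @ m @ u2" "w = u1 @ m' @ u2" "length m \<le> 1" "length m' \<le> 1"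
  using assms
proof cases
  case (substitution u1 u2 a a')
  then show ?thesis using that[of u1 "[a]" u2 "[a']"] by simp
next
  case (insertion u1 u2 a')
  then show ?thesis using that[of u1 "[]" u2 "[a']"] by simp
next
  case (deletion u1 u2 a)
  then show ?thesis using that[of u1 "[a]" u2 "[]"] by simp
qed

text \<open>An edit replaces a factor of at most one letter. Discarding the part of the common
  subsequence embedded in that factor loses at most one letter per edit. This reduces counting edit
  balls to counting subwords and superwords.\<close>

lemma edit_relpow_common_subseq:
  assumes "(v, w) \<in> edit p ^^ k"
  shows "\<exists>s. subseq s v \<and> subseq s w \<and> length v \<le> length s + k \<and> length w \<le> length s + k"
  using assms
proof (induction k arbitrary: w)
  case 0
  then show ?case by (auto intro!: exI[of _ v])
next
  case (Suc k)
  from Suc.prems obtain w' where w': "(v, w') \<in> edit p ^^ k" "(w', w) \<in> edit p" by auto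
  from Suc.IH[OF w'(1)] obtain s where s: "subseq s v" "subseq s w'"
    "length v \<le> length s + k" "length w' \<le> length s + k" by blast
  from w'(2) obtain u1 u2 m m' where m: "w' = u1 @ m @ u2" "w = u1 @ m' @ u2"
    "length m \<le> 1" "length m' \<le> 1" by (rule edit_cases)
  obtain s1 s2 s3 where split: "s = s1 @ s2 @ s3" "subseq s1 u1" "subseq s2 m" "subseq s3 u2"
    using s(2) unfolding m(1) by (metis subseq_appendE)
  have "subseq (s1 @ s3) s" unfolding split(1) by (intro list_emb_append_mono subseq_drop_many) auto
  then have "subseq (s1 @ s3) v" using s(1) subseq_order.trans by blast
  moreover have "subseq (s1 @ s3) w"
    unfolding m(2) using split by (intro list_emb_append_mono subseq_drop_many) auto
  moreover have "length s2 \<le> length m" using split(3) by (rule list_emb_length)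
  ultimately show ?case using s m split(1) by (intro exI[of _ "s1 @ s3"]) auto
qed

text \<open>Before and after an edit the word is compared with \<open>\<Phi> u1 + \<Phi> u2\<close>.
  Each comparison costs two concatenations, \<open>2 * C\<close>, and at most one letter,
  \<open>B\<close>.\<close>

lemma quasi_additive_edit_relpow:
  assumes qa: "quasi_additive C B \<Phi>" and "(v, w) \<in> edit p ^^ k"
  shows "\<bar>\<Phi> v - \<Phi> w\<bar> \<le> (4 * C + 2 * B) * real k"
  using assms(2)
proof (induction k arbitrary: w)
  case 0
  then show ?case by simp
next
  case (Suc k)
  from Suc.prems obtain w' where w': "(v, w') \<in> edit p ^^ k" "(w', w) \<in> edit p" by auto
  have "\<bar>\<Phi> w' - \<Phi> w\<bar> \<le> 4 * C + 2 * B"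
  proof -
    from w'(2) obtain u1 u2 m m' where m: "w' = u1 @ m @ u2" "w = u1 @ m' @ u2"
      "length m \<le> 1" "length m' \<le> 1" by (rule edit_cases)
    have "\<bar>\<Phi> (u1 @ n @ u2) - \<Phi> u1 - \<Phi> u2\<bar> \<le> 2 * C + B" if "length n \<le> 1" for n
    proof -
      have "\<bar>\<Phi> n\<bar> \<le> B * real (length n)" using qa by (rule quasi_additive_bound)
      also have "\<dots> \<le> B * 1"
        using that quasi_additive_nonneg(2)[OF qa] by (intro mult_left_mono) auto
      finally show ?thesis
        using quasi_additive_append[OF qa, of u1 "n @ u2"] quasi_additive_append[OF qa, of n u2]
        by linarith
    qed
    from this[OF m(3)] this[OF m(4)] show ?thesis unfolding m(1,2) by linarith
  qed
  moreover have "(4 * C + 2 * B) * real (Suc k) = (4 * C + 2 * B) * real k + (4 * C + 2 * B)"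
    by (simp add: algebra_simps)
  ultimately show ?case using Suc.IH[OF w'(1)] by linarith
qed

section \<open>Counting words at small edit distance\<close>

text \<open>A binomial theorem: every letter is kept with weight 1 or deleted with weight
  \<open>x\<close>. Summing over sets of positions would give equality; the set of subsequences
  identifies equal results, hence the inequality.\<close>

lemma sum_subseqs_power_le:
  fixes x :: real
  assumes "x \<ge> 0"
  shows "(\<Sum>s\<in>set (subseqs v). x ^ (length v - length s)) \<le> (1 + x) ^ length v"
proof (induction v)
  case Nil
  show ?case by simp
next
  case (Cons a v)
  let ?S = "set (subseqs v)"
  have len: "length s \<le> length v" if "s \<in> ?S" for s
    using that by (simp add: list_emb_length)
  have "(\<Sum>s\<in>set (subseqs (a # v)). x ^ (length (a # v) - length s))
      \<le> (\<Sum>s\<in>Cons a ` ?S. x ^ (length (a # v) - length s)) + (\<Sum>s\<in>?S. x ^ (length (a # v) - length s))"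
    using assms by (simp add: Let_def sum_Un) (auto intro!: sum_nonneg)
  also have "(\<Sum>s\<in>Cons a ` ?S. x ^ (length (a # v) - length s)) = (\<Sum>s\<in>?S. x ^ (length v - length s))"
    by (subst sum.reindex) auto
  also have "(\<Sum>s\<in>?S. x ^ (length (a # v) - length s)) = x * (\<Sum>s\<in>?S. x ^ (length v - length s))"
    unfolding sum_distrib_left by (intro sum.cong) (auto simp: Suc_diff_le len)
  also have "(\<Sum>s\<in>?S. x ^ (length v - length s)) + x * (\<Sum>s\<in>?S. x ^ (length v - length s))
      = (1 + x) * (\<Sum>s\<in>?S. x ^ (length v - length s))" by (simp add: algebra_simps)
  also have "\<dots> \<le> (1 + x) * (1 + x) ^ length v" using Cons.IH assms by (intro mult_left_mono) auto
  finally show ?case by simp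
qed

text \<open>The first letter of a superword is either inserted, which leaves \<open>card A\<close>
  choices of weight \<open>x\<close>, or it matches the head of \<open>s\<close>. Each letter thus
  contributes the factor \<open>1 + card A * x\<close>.\<close>

lemma card_superseq_power_le:
  fixes x :: real
  assumes "finite A" "x \<ge> 0"
  shows "real (card {w. set w \<subseteq> A \<and> length w = n \<and> subseq s w}) * x ^ (n - length s)
           \<le> (1 + real (card A) * x) ^ n"
proof (induction n arbitrary: s)
  case 0
  have "{w. set w \<subseteq> A \<and> length w = 0 \<and> subseq s w} = (if s = [] then {[]} else {})" by auto
  then show ?case by simp
next
  case (Suc n)
  let ?M = "\<lambda>n s. {w. set w \<subseteq> A \<and> length w = n \<and> subseq s w}"
  let ?b = "1 + real (card A) * x"
  have fin: "finite (?M n s)" for n s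
    by (rule finite_subset[OF _ finite_lists_length_eq[OF assms(1), of n]]) auto
  show ?case
  proof (cases "length s \<le> Suc n")
    case False
    then have empty: "?M (Suc n) s = {}" using list_emb_length by fastforce
    show ?thesis unfolding empty using assms by simp
  next
    case le: True
    have sub: "?M (Suc n) s \<subseteq> (\<lambda>(a, w). a # w) ` (A \<times> ?M n s) \<union>
      (if s = [] then {} else Cons (hd s) ` ?M n (tl s))"
    proof
      fix w assume w: "w \<in> ?M (Suc n) s"
      then obtain a w' where w': "w = a # w'" "length w' = n" "a \<in> A" "set w' \<subseteq> A"
        by (cases w) auto
      have "subseq s w' \<or> (s \<noteq> [] \<and> a = hd s \<and> subseq (tl s) w')"
        using w unfolding w'(1) by (cases s) (auto split: if_splits)
      then show "w \<in> (\<lambda>(a, w). a # w) ` (A \<times> ?M n s) \<union>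
        (if s = [] then {} else Cons (hd s) ` ?M n (tl s))" using w' by auto
    qed
    have c1: "card ((\<lambda>(a, w). a # w) ` (A \<times> ?M n s)) \<le> card A * card (?M n s)"
      using card_image_le[of "A \<times> ?M n s" "\<lambda>(a, w). a # w"] assms(1) fin
      by (simp add: card_cartesian_product)
    have part1: "real (card A * card (?M n s)) * x ^ (Suc n - length s) \<le> real (card A) * x * ?b ^ n"
    proof (cases "length s \<le> n")
      case True
      then have "real (card A * card (?M n s)) * x ^ (Suc n - length s)
          = real (card A) * x * (real (card (?M n s)) * x ^ (n - length s))"
        by (simp add: Suc_diff_le)
      also have "\<dots> \<le> real (card A) * x * ?b ^ n"
        using assms by (intro mult_left_mono Suc.IH) auto
      finally show ?thesis .
    next
      case False
      \<comment> \<open>Here \<open>s\<close> has exactly \<open>Suc n\<close> letters, too many for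
        a superword of length \<open>n\<close>.\<close>
      then have empty: "?M n s = {}" using list_emb_length by fastforce
      show ?thesis unfolding empty using assms by simp
    qed
    show ?thesis
    proof (cases s)
      case Nil
      have "?M (Suc n) s \<subseteq> (\<lambda>(a, w). a # w) ` (A \<times> ?M n s)"
        using sub unfolding if_P[OF Nil] by (simp only: Un_empty_right)
      then have "card (?M (Suc n) s) \<le> card A * card (?M n s)"
        by (intro order_trans[OF card_mono c1] finite_imageI finite_cartesian_product assms(1) fin)
      then have "real (card (?M (Suc n) s)) * x ^ (Suc n - length s)
          \<le> real (card A * card (?M n s)) * x ^ (Suc n - length s)"
        using assms by (intro mult_right_mono) (simp_all only: of_nat_le_iff zero_le_power)
      also note part1
      also have "real (card A) * x * ?b ^ n \<le> ?b * ?b ^ n"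
        using assms by (intro mult_right_mono) auto
      finally show ?thesis by simp
    next
      case (Cons a s')
      have "card (?M (Suc n) s) \<le> card ((\<lambda>(a, w). a # w) ` (A \<times> ?M n s) \<union> Cons a ` ?M n s')"
        using sub Cons fin assms(1) by (intro card_mono) auto
      also have "\<dots> \<le> card A * card (?M n s) + card (?M n s')"
        by (intro order_trans[OF card_Un_le] add_mono c1 card_image_le fin)
      finally have "real (card (?M (Suc n) s)) * x ^ (Suc n - length s)
          \<le> (real (card A * card (?M n s)) + real (card (?M n s'))) * x ^ (Suc n - length s)"
        using assms by (intro mult_right_mono) (auto simp flip: of_nat_add simp del: of_nat_mult)
      also have "\<dots> = real (card A * card (?M n s)) * x ^ (Suc n - length s)
          + real (card (?M n s')) * x ^ (n - length s')"
        using Cons by (simp add: algebra_simps)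
      also have "\<dots> \<le> real (card A) * x * ?b ^ n + ?b ^ n"
        by (intro add_mono part1 Suc.IH)
      finally show ?thesis by (simp add: algebra_simps)
    qed
  qed
qed

text \<open>A Chernoff bound with free parameter \<open>x\<close>; the crude count \<open>n ^ d\<close> of edit positions need not
  be \<open>exp (o(n))\<close> when \<open>d = g n\<close> for a mistake function \<open>g\<close>.\<close>

lemma card_common_subseq_le:
  fixes x :: real
  assumes "finite A" "0 < x" "x \<le> 1"
  shows "real (card {w. set w \<subseteq> A \<and> length w = n \<and>
      (\<exists>s. subseq s v \<and> subseq s w \<and> length v \<le> length s + d \<and> n \<le> length s + d)}) * x ^ (2 * d)
    \<le> (1 + x) ^ length v * (1 + real (card A) * x) ^ n"
proof -
  let ?M = "\<lambda>s. {w. set w \<subseteq> A \<and> length w = n \<and> subseq s w}"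
  let ?S = "{s \<in> set (subseqs v). length v \<le> length s + d \<and> n \<le> length s + d}"
  let ?b = "(1 + real (card A) * x) ^ n"
  have fin: "finite (?M s)" for s
    by (rule finite_subset[OF _ finite_lists_length_eq[OF assms(1), of n]]) auto
  have finS: "finite ?S" by (rule finite_subset[OF _ finite_set[of "subseqs v"]]) blast
  have "card {w. set w \<subseteq> A \<and> length w = n \<and>
      (\<exists>s. subseq s v \<and> subseq s w \<and> length v \<le> length s + d \<and> n \<le> length s + d)} \<le> card (\<Union>s\<in>?S. ?M s)"
    by (intro card_mono finite_UN_I[OF finS fin]) auto
  also have "\<dots> \<le> (\<Sum>s\<in>?S. card (?M s))" by (intro card_UN_le finS)
  finally have "real (card {w. set w \<subseteq> A \<and> length w = n \<and>
      (\<exists>s. subseq s v \<and> subseq s w \<and> length v \<le> length s + d \<and> n \<le> length s + d)}) * x ^ (2 * d)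
      \<le> (\<Sum>s\<in>?S. real (card (?M s))) * x ^ (2 * d)"
    using assms by (intro mult_right_mono) (auto simp flip: of_nat_sum)
  \<comment> \<open>One factor \<open>x ^ d\<close> pays for the letters inserted into
    \<open>s\<close>, the other for the letters deleted from \<open>v\<close>; both numbers are at
    most \<open>d\<close>.\<close>
  also have "\<dots> = (\<Sum>s\<in>?S. (real (card (?M s)) * x ^ d) * x ^ d)"
    by (simp add: sum_distrib_right mult_2 power_add mult.assoc)
  also have "\<dots> \<le> (\<Sum>s\<in>?S. ?b * x ^ (length v - length s))"
  proof (intro sum_mono mult_mono)
    fix s assume s: "s \<in> ?S"
    have "real (card (?M s)) * x ^ d \<le> real (card (?M s)) * x ^ (n - length s)"
      using assms s by (intro mult_left_mono power_decreasing) auto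
    also have "\<dots> \<le> ?b" using assms by (intro card_superseq_power_le) auto
    finally show "real (card (?M s)) * x ^ d \<le> ?b" .
    show "x ^ d \<le> x ^ (length v - length s)" using assms s by (intro power_decreasing) auto
  qed (use assms in auto)
  also have "\<dots> \<le> (\<Sum>s\<in>set (subseqs v). ?b * x ^ (length v - length s))"
    using assms by (intro sum_mono2) auto
  also have "\<dots> = ?b * (\<Sum>s\<in>set (subseqs v). x ^ (length v - length s))"
    by (simp add: sum_distrib_left)
  also have "\<dots> \<le> ?b * (1 + x) ^ length v"
    using assms by (intro mult_left_mono sum_subseqs_power_le) auto
  finally show ?thesis by (simp add: mult.commute)
qed

section \<open>Covers and pressure\<close>

lemma incseq_pressure_sum_N: "incseq (\<lambda>N. pressure_sum_N X Z t \<phi> N)"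
  unfolding pressure_sum_N_def cylinder_covers_def
  by (intro incseq_SucI INF_superset_mono) auto

text \<open>The sums increase to their limit in \<open>N\<close>, so a vanishing limit makes all of
  them vanish: covers by arbitrarily long words can be arbitrarily cheap.\<close>

lemma pressure_sum_zero_imp_cover:
  assumes "pressure_sum X Z t \<phi> = 0" "c > 0"
  obtains Y where "Y \<in> cylinder_covers X Z N"
    "(\<Sum>\<^sub>\<infinity>w\<in>Y. ennreal (exp (- t * real (length w)
        + (SUP x\<in>cylinder w \<inter> X. birkhoff_sum \<phi> (length w) x)))) < c"
proof -
  have "pressure_sum_N X Z t \<phi> N \<le> pressure_sum X Z t \<phi>"
    using incseq_le[OF incseq_pressure_sum_N pressure_sum_N_tendsto] .
  then have "pressure_sum_N X Z t \<phi> N < c" using assms by simp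
  then show ?thesis using that unfolding pressure_sum_N_def INF_less_iff by blast
qed

lemma pressure_mono:
  assumes "Z \<subseteq> Y"
  shows "pressure X Z \<phi> \<le> pressure X Y \<phi>"
proof -
  have "pressure_sum X Z t \<phi> \<le> pressure_sum X Y t \<phi>" for t
  proof (rule LIMSEQ_le[OF pressure_sum_N_tendsto pressure_sum_N_tendsto])
    show "\<exists>N. \<forall>n\<ge>N. pressure_sum_N X Z t \<phi> n \<le> pressure_sum_N X Y t \<phi> n"
      using assms unfolding pressure_sum_N_def cylinder_covers_def
      by (intro exI[of _ 0] allI impI INF_superset_mono) auto
  qed
  then have "pressure_sum X Z t \<phi> = 0" if "pressure_sum X Y t \<phi> = 0" for t
    using that by (metis le_zero_eq)
  then show ?thesis unfolding pressure_def by (intro Inf_superset_mono) auto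
qed

text \<open>All words of one length form an admissible cover of \<open>X\<close>, so their weight
  cannot be small when the pressure sum is positive. Level \<open>n\<close> admits only words longer
  than \<open>n\<close>, hence the length \<open>Suc n\<close> in the proof. Replacing the supremum
  over a cylinder by \<Phi> costs \<epsilon> in the exponent.\<close>

lemma language_sum_growth:
  assumes X: "shift_space p X" and approx: "approximates_birkhoff X \<phi> \<epsilon> C \<Phi>"
    and pos: "pressure_sum X X t \<phi> \<noteq> 0"
  obtains c where "c > 0"
    "\<forall>\<^sub>F n in sequentially. c * exp ((t - \<epsilon>) * real n) \<le> (\<Sum>w\<in>{w \<in> language X. length w = n}. exp (\<Phi> w))"
proof -
  obtain c where c: "c > 0" "ennreal c < pressure_sum X X t \<phi>"
  proof -
    obtain r where r: "0 < r" "r < pressure_sum X X t \<phi>"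
      using pos dense[of 0 "pressure_sum X X t \<phi>"] by (auto simp: zero_less_iff_neq_zero)
    then have "r < top" by (metis order.strict_trans2 top_greatest)
    with r show ?thesis using that[of "enn2real r"] by (simp add: enn2real_positive_iff)
  qed
  have "\<forall>\<^sub>F n in sequentially. ennreal c < pressure_sum_N X X t \<phi> n"
    using order_tendstoD(1)[OF pressure_sum_N_tendsto c(2)] .
  then have "\<forall>\<^sub>F n in sequentially. c * exp (- C) * exp ((t - \<epsilon>) * real (Suc n))
      \<le> (\<Sum>w\<in>{w \<in> language X. length w = Suc n}. exp (\<Phi> w))"
  proof eventually_elim
    case (elim n)
    let ?L = "{w \<in> language X. length w = Suc n}"
    have fin: "finite ?L" by (rule finite_language_length[OF X])
    have "X \<subseteq> (\<Union>w\<in>?L. cylinder w)"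
    proof
      fix x assume "x \<in> X"
      then have "map x [0..<Suc n] \<in> ?L" by (simp add: language_map_upt del: upt_Suc)
      then show "x \<in> (\<Union>w\<in>?L. cylinder w)" using cylinder_map_upt by blast
    qed
    then have "?L \<in> cylinder_covers X X n"
      using fin by (auto simp: cylinder_covers_def countable_finite)
    then have "pressure_sum_N X X t \<phi> n \<le> (\<Sum>\<^sub>\<infinity>w\<in>?L. ennreal (exp (- t * real (length w)
        + (SUP x\<in>cylinder w \<inter> X. birkhoff_sum \<phi> (length w) x))))"
      unfolding pressure_sum_N_def by (rule INF_lower)
    also have "\<dots> = (\<Sum>w\<in>?L. ennreal (exp (- t * real (length w)
        + (SUP x\<in>cylinder w \<inter> X. birkhoff_sum \<phi> (length w) x))))"
      using fin by simp
    also have "\<dots> \<le> (\<Sum>w\<in>?L. ennreal (exp (C - (t - \<epsilon>) * real (Suc n)) * exp (\<Phi> w)))"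
    proof (intro sum_mono ennreal_leI)
      fix w assume w: "w \<in> ?L"
      have "(SUP x\<in>cylinder w \<inter> X. birkhoff_sum \<phi> (length w) x) \<le> \<Phi> w + (\<epsilon> * real (length w) + C)"
      proof (rule cSUP_least)
        show "cylinder w \<inter> X \<noteq> {}" using w by (auto simp: language_def)
        fix x assume "x \<in> cylinder w \<inter> X"
        then show "birkhoff_sum \<phi> (length w) x \<le> \<Phi> w + (\<epsilon> * real (length w) + C)"
          using approximates_birkhoffD[OF approx, of x w] by auto
      qed
      then show "exp (- t * real (length w) + (SUP x\<in>cylinder w \<inter> X. birkhoff_sum \<phi> (length w) x))
          \<le> exp (C - (t - \<epsilon>) * real (Suc n)) * exp (\<Phi> w)"
        using w by (simp add: algebra_simps flip: exp_add)
    qed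
    also have "\<dots> = ennreal (exp (C - (t - \<epsilon>) * real (Suc n)) * (\<Sum>w\<in>?L. exp (\<Phi> w)))"
      by (simp add: sum_ennreal sum_distrib_left)
    finally have "ennreal c < ennreal (exp (C - (t - \<epsilon>) * real (Suc n)) * (\<Sum>w\<in>?L. exp (\<Phi> w)))"
      using elim by simp
    then have "c < exp (C - (t - \<epsilon>) * real (Suc n)) * (\<Sum>w\<in>?L. exp (\<Phi> w))"
      using c(1) by (simp add: ennreal_less_iff)
    moreover have "c * exp (- a) \<le> b" if "c < exp a * b" for a b :: real
      using that by (simp add: exp_minus field_simps)
    ultimately have "c * exp (- (C - (t - \<epsilon>) * real (Suc n))) \<le> (\<Sum>w\<in>?L. exp (\<Phi> w))"
      by blast
    moreover have "exp (- (C - (t - \<epsilon>) * real (Suc n))) = exp (- C) * exp ((t - \<epsilon>) * real (Suc n))"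
      by (simp flip: exp_add)
    ultimately show ?case by (simp add: mult.assoc)
  qed
  then have "\<forall>\<^sub>F n in sequentially. c * exp (- C) * exp ((t - \<epsilon>) * real n)
      \<le> (\<Sum>w\<in>{w \<in> language X. length w = n}. exp (\<Phi> w))"
    by (subst (asm) eventually_sequentially_Suc)
  then show ?thesis using that[of "c * exp (- C)"] c(1) by simp
qed

section \<open>Approximation by specification words\<close>

lemma mistake_function_eventually_le:
  assumes "mistake_function g" "c > 0"
  shows "\<forall>\<^sub>F n in sequentially. real (g n) \<le> c * real n"
proof -
  have "(\<lambda>n. real (g n) / real n) \<longlonglongrightarrow> 0" using assms(1) by (simp add: mistake_function_def)
  then have "\<forall>\<^sub>F n in sequentially. real (g n) / real n < c"
    using assms(2) by (rule order_tendstoD(2))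
  with eventually_gt_at_top[of 0] show ?thesis
    by eventually_elim (simp add: field_simps)
qed

lemma edit_approachable_relpow:
  assumes "shift_space p X" "G \<subseteq> language X" "edit_approachable p (language X) G"
  obtains g a where "mistake_function g" "\<And>w. w \<in> language X \<Longrightarrow> a w \<in> G"
    "\<And>w. w \<in> language X \<Longrightarrow> \<exists>k\<le>g (length w). (a w, w) \<in> edit p ^^ k"
proof -
  obtain g where g: "mistake_function g"
    "\<And>w. w \<in> language X \<Longrightarrow> \<exists>v\<in>G. edit_distance p v w \<le> g (length w)"
    using assms(3) by (auto simp: edit_approachable_def)
  obtain a where a: "\<And>w. w \<in> language X \<Longrightarrow> a w \<in> G"
    "\<And>w. w \<in> language X \<Longrightarrow> edit_distance p (a w) w \<le> g (length w)"
    using g(2) by metis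
  have "\<exists>k\<le>g (length w). (a w, w) \<in> edit p ^^ k" if "w \<in> language X" for w
    using edit_distance_attained[of "a w" p w] a[OF that] language_lists[OF assms(1)] assms(2) that
    by blast
  with g(1) a(1) show ?thesis by (rule that)
qed

lemma edit_relpow_length:
  assumes "(v, w) \<in> edit p ^^ k"
  shows "length v \<le> length w + k" "length w \<le> length v + k"
  using edit_relpow_common_subseq[OF assms] by (auto dest!: list_emb_length)

text \<open>The weighted count bounds \<open>card * x ^ (2 * d)\<close> by a power of
  \<open>1 + p * x\<close>. The parameter stays free: a small \<open>x\<close> tames the term
  proportional to \<open>n\<close>, while the large \<open>ln (1 / x)\<close> multiplies only
  \<open>d\<close>.\<close>

lemma card_edit_ball_le:
  fixes x :: real
  assumes X: "shift_space p X" and "p \<ge> 1" and x: "0 < x" "x \<le> 1"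
  shows "real (card {w \<in> language X. length w = n \<and> (\<exists>k\<le>d. (v, w) \<in> edit p ^^ k)})
           \<le> exp (2 * real d * ln (1 / x) + real p * x * (2 * real n + real d))" (is "real (card ?S) \<le> _")
proof (cases "?S = {}")
  case True
  then show ?thesis by (simp only: card.empty) simp
next
  case False
  then obtain w k where "(v, w) \<in> edit p ^^ k" "length w = n" "k \<le> d" by auto
  then have len: "length v \<le> n + d" using edit_relpow_length[of v w k p] by simp
  let ?T = "{w. set w \<subseteq> alphabet p \<and> length w = n \<and>
      (\<exists>s. subseq s v \<and> subseq s w \<and> length v \<le> length s + d \<and> n \<le> length s + d)}"
  have "?S \<subseteq> ?T"
  proof
    fix w assume "w \<in> ?S"
    then obtain k where w: "w \<in> language X" "length w = n" "k \<le> d" "(v, w) \<in> edit p ^^ k" by blast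
    obtain s where "subseq s v" "subseq s w" "length v \<le> length s + k" "length w \<le> length s + k"
      using edit_relpow_common_subseq[OF w(4)] by blast
    then have "\<exists>s. subseq s v \<and> subseq s w \<and> length v \<le> length s + d \<and> n \<le> length s + d"
      using w by (intro exI[of _ s]) auto
    then show "w \<in> ?T" using w language_lists[OF X] by auto
  qed
  moreover have "finite ?T"
    by (rule finite_subset[OF _ finite_lists_length_eq[of "alphabet p" n]]) (auto simp: alphabet_def)
  ultimately have "real (card ?S) * x ^ (2 * d) \<le> real (card ?T) * x ^ (2 * d)"
    using x by (intro mult_right_mono) (auto intro: card_mono)
  also have "\<dots> \<le> (1 + x) ^ length v * (1 + real (card (alphabet p)) * x) ^ n"
    using x by (intro card_common_subseq_le) (auto simp: alphabet_def)
  also have "\<dots> \<le> (1 + real p * x) ^ (n + d) * (1 + real p * x) ^ n"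
  proof (intro mult_mono)
    have "(1 + x) ^ length v \<le> (1 + x) ^ (n + d)" using x len by (intro power_increasing) auto
    also have "\<dots> \<le> (1 + real p * x) ^ (n + d)" using x \<open>p \<ge> 1\<close> by (intro power_mono) auto
    finally show "(1 + x) ^ length v \<le> (1 + real p * x) ^ (n + d)" .
  qed (use x in \<open>auto simp: alphabet_def\<close>)
  also have "\<dots> = (1 + real p * x) ^ (n + d + n)" by (simp only: power_add)
  also have "\<dots> = (1 + real p * x) ^ (2 * n + d)"
    by (intro arg_cong[where f = "\<lambda>k. _ ^ k"]) simp
  also have "\<dots> \<le> exp (real p * x) ^ (2 * n + d)"
    using x by (intro power_mono exp_ge_add_one_self) auto
  also have "\<dots> = exp (real p * x * (2 * real n + real d))"
    by (simp add: exp_of_nat_mult[symmetric] mult.commute)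
  finally have "real (card ?S) * x ^ (2 * d) \<le> exp (real p * x * (2 * real n + real d))" .
  moreover have "x ^ (2 * d) = exp (- (2 * real d * ln (1 / x)))"
  proof -
    have "x ^ (2 * d) = exp (real (2 * d) * ln x)" using x by (simp only: exp_of_nat_mult exp_ln)
    then show ?thesis using x by (simp add: ln_div)
  qed
  ultimately have "real (card ?S) * exp (- (2 * real d * ln (1 / x)))
      \<le> exp (real p * x * (2 * real n + real d))" by simp
  then have "real (card ?S) \<le> exp (real p * x * (2 * real n + real d)) * exp (2 * real d * ln (1 / x))"
    by (simp add: exp_minus field_simps)
  then show ?thesis by (simp add: add.commute flip: exp_add)
qed

text \<open>The order of choice matters: \<open>x\<close> is fixed first, depending on \<theta> and
  \<open>p\<close>, and makes the second term of the exponent at most half of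
  \<open>\<theta> * n\<close>. Then \<open>ln (1 / x)\<close> is a constant, and sublinearity of
  \<open>g\<close> bounds the first term by the other half.\<close>

lemma eventually_card_edit_ball_le:
  assumes X: "shift_space p X" and p: "p \<ge> 1" and g: "mistake_function g" and "\<theta> > 0"
  shows "\<forall>\<^sub>F n in sequentially. \<forall>v.
    real (card {w \<in> language X. length w = n \<and> (\<exists>k\<le>g n. (v, w) \<in> edit p ^^ k)}) \<le> exp (\<theta> * real n)"
proof -
  define x where "x = min 1 (\<theta> / (6 * real p))"
  have x: "0 < x" "x \<le> 1" "real p * x \<le> \<theta> / 6"
    using p \<open>\<theta> > 0\<close> by (auto simp: x_def min_def field_simps)
  define M where "M = ln (1 / x)"
  have M: "M \<ge> 0" using x by (simp add: M_def)
  define c where "c = min 1 (\<theta> / (4 * (M + 1)))"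
  have c: "c > 0" "c \<le> 1" "2 * c * M \<le> \<theta> / 2"
  proof -
    show "c > 0" "c \<le> 1" using M \<open>\<theta> > 0\<close> by (auto simp: c_def)
    have "c * M \<le> \<theta> / (4 * (M + 1)) * (M + 1)" using M \<open>\<theta> > 0\<close> by (intro mult_mono) (auto simp: c_def)
    also have "\<dots> = \<theta> / 4" using M by (auto simp: divide_simps)
    finally show "2 * c * M \<le> \<theta> / 2" by simp
  qed
  show ?thesis
    using mistake_function_eventually_le[OF g c(1)]
  proof eventually_elim
    case (elim n)
    have "real (g n) * M \<le> c * real n * M" using elim M by (intro mult_right_mono) auto
    also have "2 * (c * real n * M) = (2 * c * M) * real n" by simp
    also have "\<dots> \<le> \<theta> / 2 * real n" using c(3) by (intro mult_right_mono) auto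
    finally have "2 * real (g n) * M \<le> \<theta> / 2 * real n" by simp
    moreover have "real (g n) \<le> real n"
      using elim mult_right_mono[OF c(2), of "real n"] by simp
    then have "real p * x * (2 * real n + real (g n)) \<le> \<theta> / 6 * (3 * real n)"
      using x(3) \<open>\<theta> > 0\<close> by (intro mult_mono) auto
    ultimately have le: "2 * real (g n) * ln (1 / x) + real p * x * (2 * real n + real (g n)) \<le> \<theta> * real n"
      by (simp add: M_def)
    show ?case
    proof
      fix v
      show "real (card {w \<in> language X. length w = n \<and> (\<exists>k\<le>g n. (v, w) \<in> edit p ^^ k)}) \<le> exp (\<theta> * real n)"
        using card_edit_ball_le[OF X p x(1,2), of n "g n" v] le
        by (meson exp_le_cancel_iff order_trans)
    qed
  qed
qed

lemma ex_heavy_fibre: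
  fixes f :: "'a \<Rightarrow> real"
  assumes "finite V" "finite K" "\<kappa> ` V \<subseteq> K" "K \<noteq> {}"
  shows "\<exists>k\<in>K. sum f V \<le> real (card K) * sum f {v \<in> V. \<kappa> v = k}"
proof (rule ccontr)
  assume no: "\<not> ?thesis"
  have lt: "real (card K) * sum f {v \<in> V. \<kappa> v = k} < sum f V" if "k \<in> K" for k
    using no that by (auto simp: not_le)
  have "real (card K) * sum f V = (\<Sum>k\<in>K. real (card K) * sum f {v \<in> V. \<kappa> v = k})"
    unfolding sum_distrib_left[symmetric] using sum.group[OF assms(1-3), of f] by simp
  also have "\<dots> < (\<Sum>k\<in>K. sum f V)" using lt assms by (intro sum_strict_mono) auto
  finally show False by simp
qed

text \<open>A fibre of the map into \<open>G\<close> lies in an edit ball, so its size costs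
  \<open>\<theta> / 4\<close> in the exponent, and the variation of \<Phi> along it another
  \<open>\<theta> / 4\<close>. Edits change lengths, so the words obtained are sorted by length as
  well as by \<Psi> in steps of \<open>\<eta> * n\<close>. There are only linearly many classes,
  costing a third \<open>\<theta> / 4\<close>.\<close>

lemma eventually_ex_uniform_words:
  fixes \<theta> \<eta> :: real
  assumes X: "shift_space p X" and p: "p \<ge> 1" and G: "G \<subseteq> language X"
    and approach: "edit_approachable p (language X) G"
    and \<Phi>: "quasi_additive C B \<Phi>" and \<Psi>: "quasi_additive C' B' \<Psi>"
    and pos: "\<theta> > 0" "\<eta> > 0" "c > 0"
    and growth: "\<forall>\<^sub>F n in sequentially. c * exp (r * real n) \<le> (\<Sum>w\<in>{w \<in> language X. length w = n}. exp (\<Phi> w))"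
  shows "\<forall>\<^sub>F n in sequentially. \<exists>m W \<gamma>. finite W \<and> W \<noteq> {} \<and> W \<subseteq> G \<and>
    (\<forall>w\<in>W. length w = m \<and> \<bar>\<Psi> w - \<gamma> * real m\<bar> \<le> \<eta> * real n) \<and> \<bar>\<gamma>\<bar> \<le> B' \<and>
    \<bar>real m - real n\<bar> \<le> \<theta> * real n \<and> exp ((r - \<theta>) * real n) \<le> (\<Sum>w\<in>W. exp (\<Phi> w))"
proof -
  obtain g a where g: "mistake_function g" and aG: "\<And>w. w \<in> language X \<Longrightarrow> a w \<in> G"
    and a: "\<And>w. w \<in> language X \<Longrightarrow> \<exists>k\<le>g (length w). (a w, w) \<in> edit p ^^ k"
    using edit_approachable_relpow[OF X G approach] by blast
  define D where "D = 4 * C + 2 * B"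
  have D: "D \<ge> 0" using quasi_additive_nonneg[OF \<Phi>] by (simp add: D_def)
  have B': "B' \<ge> 0" using quasi_additive_nonneg[OF \<Psi>] by simp
  \<comment> \<open>The words have length at most \<open>2 * n\<close>, so
    \<open>2 * B' / \<eta>\<close> bounds \<Psi> in units of \<open>\<eta> * n\<close>; the extra 1
    allows for rounding down.\<close>
  define J where "J = \<lceil>2 * B' / \<eta>\<rceil> + 1"
  have "0 \<le> 2 * B' / \<eta>" using B' pos by simp
  then have J: "2 * B' / \<eta> \<le> real_of_int J - 1" "J \<ge> 1"
    unfolding J_def by linarith+
  define c2 where "c2 = min (min 1 \<theta>) (\<theta> / (4 * (D + 1)))"
  have c2: "c2 > 0" "c2 \<le> 1" "c2 \<le> \<theta>" "D * c2 \<le> \<theta> / 4"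
  proof -
    show "c2 > 0" "c2 \<le> 1" "c2 \<le> \<theta>" using D pos by (auto simp: c2_def)
    have "D * c2 \<le> (D + 1) * (\<theta> / (4 * (D + 1)))" using D pos by (intro mult_mono) (auto simp: c2_def)
    also have "\<dots> = \<theta> / 4" using D by (auto simp: divide_simps)
    finally show "D * c2 \<le> \<theta> / 4" .
  qed
  \<comment> \<open>Dividing by \<open>c\<close> puts a factor \<open>c\<close> into the bound for
    the number of classes, which later cancels the \<open>c\<close> of the growth
    hypothesis.\<close>
  have "real_of_int (2 * J + 1) / c > 0" using J pos by auto
  then have poly: "\<forall>\<^sub>F n in sequentially. (2 * real n + 1) * (real_of_int (2 * J + 1) / c) \<le> exp (\<theta> / 4 * real n)"
    using pos(1) by real_asymp
  have "\<theta> / 4 > 0" using pos by simp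
  from growth mistake_function_eventually_le[OF g c2(1)]
    eventually_card_edit_ball_le[OF X p g \<open>\<theta> / 4 > 0\<close>] poly eventually_gt_at_top[of 0]
  show ?thesis
  proof eventually_elim
    case (elim n)
    note growth = elim(1) and gn = elim(2) and ball = elim(3)[rule_format] and poly = elim(4) and n = elim(5)
    let ?L = "{w \<in> language X. length w = n}"
    let ?V = "a ` ?L"
    have finL: "finite ?L" by (rule finite_language_length[OF X])
    have g_le: "real (g n) \<le> real n" "real (g n) \<le> \<theta> * real n"
      using gn mult_right_mono[OF c2(2), of "real n"] mult_right_mono[OF c2(3), of "real n"] by auto
    have Dg: "D * real (g n) \<le> \<theta> / 4 * real n"
    proof -
      have "D * real (g n) \<le> D * (c2 * real n)" using gn D by (rule mult_left_mono)
      also have "\<dots> = (D * c2) * real n" by simp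
      also have "\<dots> \<le> \<theta> / 4 * real n" using c2(4) by (rule mult_right_mono) simp
      finally show ?thesis .
    qed
    have lenV: "\<bar>real (length v) - real n\<bar> \<le> real (g n)" if "v \<in> ?V" for v
    proof -
      obtain w where w: "w \<in> ?L" "v = a w" using \<open>v \<in> ?V\<close> by blast
      then obtain k where "k \<le> g n" "(v, w) \<in> edit p ^^ k" using a[of w] by auto
      with w show ?thesis using edit_relpow_length[of v w k p] by auto
    qed
    have "c * exp (r * real n) \<le> (\<Sum>w\<in>?L. exp (\<Phi> w))" by (rule growth)
    also have "\<dots> = (\<Sum>v\<in>?V. \<Sum>w\<in>{w \<in> ?L. a w = v}. exp (\<Phi> w))"
      by (rule sum.image_gen[OF finL])
    also have "\<dots> \<le> (\<Sum>v\<in>?V. exp (\<theta> / 2 * real n) * exp (\<Phi> v))"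
    proof (intro sum_mono)
      fix v
      let ?F = "{w \<in> ?L. a w = v}" and ?S = "{w \<in> language X. length w = n \<and> (\<exists>k\<le>g n. (v, w) \<in> edit p ^^ k)}"
      have "(\<Sum>w\<in>?F. exp (\<Phi> w)) \<le> (\<Sum>w\<in>?F. exp (\<Phi> v + \<theta> / 4 * real n))"
      proof (intro sum_mono)
        fix w assume "w \<in> ?F"
        then obtain k where k: "k \<le> g n" "(v, w) \<in> edit p ^^ k" using a by auto
        have "\<bar>\<Phi> v - \<Phi> w\<bar> \<le> D * real k"
          using quasi_additive_edit_relpow[OF \<Phi> k(2)] by (simp add: D_def)
        also have "\<dots> \<le> D * real (g n)" using k(1) D by (intro mult_left_mono) auto
        finally show "exp (\<Phi> w) \<le> exp (\<Phi> v + \<theta> / 4 * real n)" using Dg by simp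
      qed
      also have "\<dots> = real (card ?F) * exp (\<Phi> v + \<theta> / 4 * real n)" by simp
      also have "\<dots> \<le> exp (\<theta> / 4 * real n) * exp (\<Phi> v + \<theta> / 4 * real n)"
      proof (intro mult_right_mono)
        have "?F \<subseteq> ?S" using a by auto
        moreover have "finite ?S" using finL by (rule finite_subset[rotated]) auto
        ultimately have "card ?F \<le> card ?S" by (rule card_mono[rotated])
        then show "real (card ?F) \<le> exp (\<theta> / 4 * real n)" using ball[of v] by linarith
      qed simp
      finally show "(\<Sum>w\<in>?F. exp (\<Phi> w)) \<le> exp (\<theta> / 2 * real n) * exp (\<Phi> v)"
        by (simp add: algebra_simps flip: exp_add)
    qed
    also have "\<dots> = exp (\<theta> / 2 * real n) * (\<Sum>v\<in>?V. exp (\<Phi> v))" by (simp add: sum_distrib_left)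
    finally have sumV: "c * exp (r * real n) \<le> exp (\<theta> / 2 * real n) * (\<Sum>v\<in>?V. exp (\<Phi> v))" .

    define \<kappa> where "\<kappa> v = (length v, \<lfloor>\<Psi> v / (\<eta> * real n)\<rfloor>)" for v
    define K where "K = {0..2 * n} \<times> {- J..J}"
    have \<kappa>K: "\<kappa> ` ?V \<subseteq> K"
    proof (intro image_subsetI)
      fix v assume v: "v \<in> ?V"
      then have len: "real (length v) \<le> 2 * real n" using lenV[OF v] g_le(1) by linarith
      have "\<bar>\<Psi> v\<bar> \<le> B' * real (length v)" using \<Psi> by (rule quasi_additive_bound)
      also have "\<dots> \<le> B' * (2 * real n)" using len B' by (rule mult_left_mono)
      finally have "\<bar>\<Psi> v / (\<eta> * real n)\<bar> \<le> 2 * B' / \<eta>"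
        using pos n by (simp add: abs_mult field_simps)
      then have "\<bar>\<Psi> v / (\<eta> * real n)\<bar> \<le> real_of_int J - 1" using J by linarith
      then have "- J \<le> \<lfloor>\<Psi> v / (\<eta> * real n)\<rfloor>" "\<lfloor>\<Psi> v / (\<eta> * real n)\<rfloor> \<le> J"
        by linarith+
      then show "\<kappa> v \<in> K" using len by (simp add: \<kappa>_def K_def)
    qed
    have "finite ?V" "finite K" "K \<noteq> {}" using finL J by (auto simp: K_def)
    then obtain k where k: "k \<in> K"
      "(\<Sum>v\<in>?V. exp (\<Phi> v)) \<le> real (card K) * (\<Sum>v\<in>{v \<in> ?V. \<kappa> v = k}. exp (\<Phi> v))"
      using ex_heavy_fibre[of ?V K \<kappa> "\<lambda>v. exp (\<Phi> v)"] \<kappa>K by blast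
    let ?W = "{v \<in> ?V. \<kappa> v = k}"
    define m where "m = fst k"
    have "real (card K) = (2 * real n + 1) * real_of_int (2 * J + 1)"
      using J by (simp add: K_def card_cartesian_product algebra_simps)
    also have "\<dots> = c * ((2 * real n + 1) * (real_of_int (2 * J + 1) / c))" using pos(3) by simp
    also have "\<dots> \<le> c * exp (\<theta> / 4 * real n)"
      using poly pos(3) by (intro mult_left_mono) auto
    finally have cardK: "real (card K) \<le> c * exp (\<theta> / 4 * real n)" .
    have "c * exp (r * real n) \<le> exp (\<theta> / 2 * real n) * (real (card K) * (\<Sum>v\<in>?W. exp (\<Phi> v)))"
      by (rule order_trans[OF sumV mult_left_mono[OF k(2)]]) simp
    also have "\<dots> \<le> exp (\<theta> / 2 * real n) * (c * exp (\<theta> / 4 * real n) * (\<Sum>v\<in>?W. exp (\<Phi> v)))"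
      using cardK by (intro mult_left_mono mult_right_mono sum_nonneg) auto
    also have "\<dots> = c * (exp (3 * \<theta> / 4 * real n) * (\<Sum>v\<in>?W. exp (\<Phi> v)))"
      by (simp add: algebra_simps flip: exp_add)
    finally have "exp (r * real n) \<le> exp (3 * \<theta> / 4 * real n) * (\<Sum>v\<in>?W. exp (\<Phi> v))"
      using pos(3) by simp
    also have "\<dots> \<le> exp (\<theta> * real n) * (\<Sum>v\<in>?W. exp (\<Phi> v))"
      using pos(1) by (intro mult_right_mono sum_nonneg) auto
    finally have "exp (r * real n) \<le> exp (\<theta> * real n) * (\<Sum>v\<in>?W. exp (\<Phi> v))" .
    moreover have "exp (a - b) \<le> s" if "exp a \<le> exp b * s" for a b s :: real
      using that by (simp add: exp_diff field_simps)
    ultimately have sumW: "exp ((r - \<theta>) * real n) \<le> (\<Sum>v\<in>?W. exp (\<Phi> v))"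
      unfolding left_diff_distrib by blast
    have "?W \<noteq> {}"
    proof
      assume empty: "?W = {}"
      from sumW show False unfolding empty by simp
    qed
    then obtain w0 where w0: "w0 \<in> ?W" by blast
    have lenW: "length w = m" if "w \<in> ?W" for w using that by (auto simp: \<kappa>_def m_def)
    \<comment> \<open>For \<open>m = 0\<close> this is 0 by convention, and \<open>\<Psi> w0\<close>
      is 0 too, so the product with \<open>m\<close> is right in every case.\<close>
    define \<gamma> where "\<gamma> = \<Psi> w0 / real m"
    have \<Psi>0: "\<bar>\<Psi> w0\<bar> \<le> B' * real m" using quasi_additive_bound[OF \<Psi>, of w0] lenW[OF w0] by simp
    have \<gamma>m: "\<gamma> * real m = \<Psi> w0" using \<Psi>0 by (cases "m = 0") (auto simp: \<gamma>_def)
    have \<gamma>B: "\<bar>\<gamma>\<bar> \<le> B'" using \<Psi>0 B' by (cases "m = 0") (auto simp: \<gamma>_def field_simps)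
    have close: "\<bar>\<Psi> w - \<gamma> * real m\<bar> \<le> \<eta> * real n" if w: "w \<in> ?W" for w
    proof -
      have "\<lfloor>\<Psi> w / (\<eta> * real n)\<rfloor> = \<lfloor>\<Psi> w0 / (\<eta> * real n)\<rfloor>"
        using w w0 by (auto simp: \<kappa>_def)
      then have "\<bar>\<Psi> w / (\<eta> * real n) - \<Psi> w0 / (\<eta> * real n)\<bar> \<le> 1" by linarith
      then have "\<bar>(\<Psi> w - \<Psi> w0) / (\<eta> * real n)\<bar> \<le> 1" by (simp add: diff_divide_distrib)
      then show ?thesis unfolding \<gamma>m using pos n by (simp add: abs_divide field_simps)
    qed
    have mn: "\<bar>real m - real n\<bar> \<le> \<theta> * real n"
      using lenV[of w0] w0 lenW[OF w0] g_le(2) by auto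
    have WG: "?W \<subseteq> G" using aG by auto
    have finW: "finite ?W" using finL by simp
    show ?case
      by (rule exI[of _ m], rule exI[of _ ?W], rule exI[of _ \<gamma>], intro conjI ballI)
        (fact finW \<open>?W \<noteq> {}\<close> WG lenW close \<gamma>B mn sumW)+
  qed
qed

section \<open>Oscillation of Birkhoff averages\<close>

lemma birkhoff_sum_bound:
  assumes X: "shift_space p X" and B: "\<forall>x\<in>X. \<bar>f x\<bar> \<le> B" and x: "x \<in> X"
  shows "\<bar>birkhoff_sum f n x\<bar> \<le> B * real n"
proof -
  have "\<bar>birkhoff_sum f n x\<bar> \<le> (\<Sum>i<n. B)"
    unfolding birkhoff_sum_def
    using B shift_space_funpow[OF X x] by (intro order_trans[OF sum_abs] sum_mono) blast
  then show ?thesis by (simp add: mult.commute)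
qed

text \<open>The orbit is cut into blocks of length \<open>l\<close>, each starting at a point of
  \<open>X\<close>; the fewer than \<open>l\<close> remaining terms give the constant.\<close>

lemma birkhoff_sum_le_of_block_bound:
  assumes X: "shift_space p X" and B: "\<forall>x\<in>X. \<bar>f x\<bar> \<le> B"
    and "l > 0" and block: "\<forall>y\<in>X. birkhoff_sum f l y \<le> b * real l" and x: "x \<in> X"
  shows "birkhoff_sum f n x \<le> b * real n + (\<bar>b\<bar> + B) * real l"
proof -
  have multiple: "birkhoff_sum f (l * k) x \<le> b * real (l * k)" for k
  proof (induction k)
    case (Suc k)
    have "birkhoff_sum f (l * Suc k) x = birkhoff_sum f (l * k) x + birkhoff_sum f l ((shift ^^ (l * k)) x)"
      using birkhoff_sum_add[of f "l * k" l x] by (simp add: add.commute)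
    also have "\<dots> \<le> b * real (l * k) + b * real l"
      using block shift_space_funpow[OF X x] by (intro add_mono Suc) blast
    finally show ?case by (simp add: algebra_simps)
  qed (simp add: birkhoff_sum_def)
  let ?q = "l * (n div l)" and ?r = "n mod l"
  have r: "real ?r \<le> real l" using \<open>l > 0\<close> by (simp add: less_imp_le)
  have Bpos: "B \<ge> 0" using B x by force
  have "birkhoff_sum f n x = birkhoff_sum f ?q x + birkhoff_sum f ?r ((shift ^^ ?q) x)"
    using birkhoff_sum_add[of f ?q ?r x] by simp
  also have "\<dots> \<le> b * real ?q + B * real ?r"
    using multiple[of "n div l"] birkhoff_sum_bound[OF X B shift_space_funpow[OF X x], of ?r ?q]
    by (intro add_mono) auto
  also have "b * real ?q = b * real n - b * real ?r"
  proof -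
    have "real n = real ?q + real ?r" by (metis of_nat_add mult_div_mod_eq)
    then show ?thesis by (simp add: algebra_simps)
  qed
  also have "b * real n - b * real ?r + B * real ?r = b * real n + (B - b) * real ?r" by (simp add: algebra_simps)
  also have "\<dots> \<le> b * real n + (\<bar>b\<bar> + B) * real l"
    using r Bpos by (intro add_left_mono mult_mono) auto
  finally show ?thesis .
qed

text \<open>If all blocks of one length \<open>l\<close> had average below \<open>b\<close>, so
  would all long orbit segments, up to a bounded error. The length \<open>l\<close> is arbitrary,
  which is needed because the filler must have a prescribed length.\<close>

lemma ex_block_above:
  assumes X: "shift_space p X" and cont: "continuous_on X f" and x: "x \<in> X"
    and freq: "\<exists>\<^sub>F n in sequentially. birkhoff_sum f n x / real n \<ge> \<beta>" and "b < \<beta>"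
  shows "\<exists>y\<in>X. birkhoff_sum f l y \<ge> b * real l"
proof (rule ccontr)
  assume no: "\<not> ?thesis"
  then have "l > 0" using x by (auto simp: birkhoff_sum_def intro!: Nat.gr0I)
  obtain B where B: "\<forall>x\<in>X. \<bar>f x\<bar> \<le> B" using shift_space_bounded[OF X cont] .
  define M where "M = (\<bar>b\<bar> + B) * real l"
  have le: "birkhoff_sum f n x \<le> b * real n + M" for n
    unfolding M_def using no by (intro birkhoff_sum_le_of_block_bound[OF X B \<open>l > 0\<close> _ x]) force
  have "\<forall>\<^sub>F n in sequentially. M < (\<beta> - b) * real n" using \<open>b < \<beta>\<close> by real_asymp
  with eventually_gt_at_top[of 0]
  have "\<forall>\<^sub>F n in sequentially. \<not> birkhoff_sum f n x / real n \<ge> \<beta>"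
  proof eventually_elim
    case (elim n)
    then show ?case using le[of n] by (simp add: field_simps not_le)
  qed
  with freq show False by (simp add: frequently_def)
qed

lemma ex_block_below:
  assumes X: "shift_space p X" and cont: "continuous_on X f" and x: "x \<in> X"
    and freq: "\<exists>\<^sub>F n in sequentially. birkhoff_sum f n x / real n \<le> \<alpha>" and "\<alpha> < a"
  shows "\<exists>y\<in>X. birkhoff_sum f l y \<le> a * real l"
proof -
  have "\<exists>y\<in>X. birkhoff_sum (\<lambda>x. - f x) l y \<ge> - a * real l"
  proof (rule ex_block_above[OF X _ x])
    show "continuous_on X (\<lambda>x. - f x)" using cont by (rule continuous_on_minus)
    show "\<exists>\<^sub>F n in sequentially. birkhoff_sum (\<lambda>x. - f x) n x / real n \<ge> - \<alpha>"
      using freq by (simp add: birkhoff_sum_uminus)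
  qed (use assms in simp)
  then show ?thesis by (simp add: birkhoff_sum_uminus)
qed

text \<open>Bounded averages have a cluster point, and divergence keeps them at distance at least
  some \<open>e\<close> from it infinitely often. The two levels are placed strictly between, since
  passing to blocks of every length loses a little.\<close>

lemma irregular_imp_blocks:
  assumes X: "shift_space p X" and cont: "continuous_on X f" and x: "x \<in> irregular_set X f"
  obtains \<alpha> \<beta> where "\<alpha> < \<beta>" "\<And>l. \<exists>y\<in>X. birkhoff_sum f l y \<ge> \<beta> * real l"
    "\<And>l. \<exists>y\<in>X. birkhoff_sum f l y \<le> \<alpha> * real l"
proof -
  let ?a = "\<lambda>n. birkhoff_sum f n x / real n"
  have xX: "x \<in> X" and div: "\<not> convergent ?a" using x by (auto simp: irregular_set_def)
  obtain B where B: "B \<ge> 0" "\<forall>x\<in>X. \<bar>f x\<bar> \<le> B" using shift_space_bounded[OF X cont] .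
  have "\<bar>?a n\<bar> \<le> B" for n
    using birkhoff_sum_bound[OF X B(2) xX, of n] B(1) by (cases "n = 0") (auto simp: field_simps)
  then have "bounded (range ?a)" by (auto simp: bounded_iff)
  then obtain l r where r: "strict_mono r" "(?a \<circ> r) \<longlonglongrightarrow> l"
    using bounded_imp_convergent_subsequence by blast
  have near: "\<exists>\<^sub>F n in sequentially. \<bar>?a n - l\<bar> < e" if "e > 0" for e
  proof -
    have "\<forall>\<^sub>F n in sequentially. \<bar>?a (r n) - l\<bar> < e"
      using tendstoD[OF r(2) that] by (simp add: dist_real_def)
    then have "\<exists>\<^sub>F n in sequentially. \<bar>?a (r n) - l\<bar> < e" by (rule eventually_frequently[rotated]) simp
    then show ?thesis
      using filterlim_subseq[OF r(1)] unfolding frequently_def filterlim_iff by blast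
  qed
  have "\<not> ?a \<longlonglongrightarrow> l" using div convergentI by blast
  then obtain e where e: "e > 0" "\<exists>\<^sub>F n in sequentially. e \<le> \<bar>?a n - l\<bar>"
    by (auto simp: tendsto_iff frequently_def dist_real_def not_le)
  have "(\<exists>\<^sub>F n in sequentially. l + e \<le> ?a n) \<or> (\<exists>\<^sub>F n in sequentially. ?a n \<le> l - e)"
    unfolding frequently_disj_iff[symmetric] using e(2) by (rule frequently_elim1) linarith
  then show ?thesis
  proof
    assume f: "\<exists>\<^sub>F n in sequentially. l + e \<le> ?a n"
    have f': "\<exists>\<^sub>F n in sequentially. ?a n \<le> l + e / 4"
      by (rule frequently_elim1[OF near[of "e / 4"]]) (use e(1) in simp, linarith)
    show ?thesis
      using that[of "l + e / 2" "l + 3 * e / 4"] ex_block_above[OF X cont xX f, of "l + 3 * e / 4"]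
        ex_block_below[OF X cont xX f', of "l + e / 2"] e(1) by simp
  next
    assume f: "\<exists>\<^sub>F n in sequentially. ?a n \<le> l - e"
    have f': "\<exists>\<^sub>F n in sequentially. l - e / 4 \<le> ?a n"
      by (rule frequently_elim1[OF near[of "e / 4"]]) (use e(1) in simp, linarith)
    show ?thesis
      using that[of "l - 3 * e / 4" "l - e / 2"] ex_block_above[OF X cont xX f', of "l - e / 2"]
        ex_block_below[OF X cont xX f, of "l - 3 * e / 4"] e(1) by simp
  qed
qed

section \<open>Filler words\<close>

text \<open>The word read off a block with large sum is moved into \<open>G\<close>. Half of
  \<open>\<zeta> * l\<close> pays for the edits and half for the constant \<open>C\<close>. Applied
  to the negated function, this also yields fillers with small average.\<close>

lemma eventually_ex_filler:
  assumes X: "shift_space p X" and G: "G \<subseteq> language X"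
    and approach: "edit_approachable p (language X) G"
    and \<Psi>: "quasi_additive C B \<Psi>" and approx: "approximates_birkhoff X f \<epsilon> C \<Psi>"
    and blocks: "\<And>l. \<exists>y\<in>X. birkhoff_sum f l y \<ge> \<beta> * real l" and "\<zeta> > 0"
  shows "\<forall>\<^sub>F l in sequentially. \<exists>v\<in>G. \<bar>real (length v) - real l\<bar> \<le> \<zeta> * real l \<and>
    (\<beta> - \<epsilon> - \<zeta>) * real l \<le> \<Psi> v"
proof -
  obtain g a where g: "mistake_function g" and aG: "\<And>w. w \<in> language X \<Longrightarrow> a w \<in> G"
    and a: "\<And>w. w \<in> language X \<Longrightarrow> \<exists>k\<le>g (length w). (a w, w) \<in> edit p ^^ k"
    using edit_approachable_relpow[OF X G approach] by blast
  define D where "D = 4 * C + 2 * B"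
  have D: "D \<ge> 0" using quasi_additive_nonneg[OF \<Psi>] by (simp add: D_def)
  define c where "c = min \<zeta> (\<zeta> / (2 * (D + 1)))"
  have c: "c > 0" "c \<le> \<zeta>" "D * c \<le> \<zeta> / 2"
  proof -
    show "c > 0" "c \<le> \<zeta>" using D \<open>\<zeta> > 0\<close> by (auto simp: c_def)
    have "D * c \<le> (D + 1) * (\<zeta> / (2 * (D + 1)))" using D \<open>\<zeta> > 0\<close> by (intro mult_mono) (auto simp: c_def)
    also have "\<dots> = \<zeta> / 2" using D by (auto simp: divide_simps)
    finally show "D * c \<le> \<zeta> / 2" .
  qed
  have "\<forall>\<^sub>F l in sequentially. C \<le> \<zeta> / 2 * real l" using \<open>\<zeta> > 0\<close> by real_asymp
  with mistake_function_eventually_le[OF g c(1)] show ?thesis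
  proof eventually_elim
    case (elim l)
    obtain y where y: "y \<in> X" "birkhoff_sum f l y \<ge> \<beta> * real l" using blocks by blast
    let ?w = "map y [0..<l]"
    have w: "?w \<in> language X" using y(1) by (rule language_map_upt)
    obtain k where k: "k \<le> g l" "(a ?w, ?w) \<in> edit p ^^ k" using a[OF w] by auto
    have "D * real k \<le> D * (c * real l)" using k(1) elim(1) D by (intro mult_left_mono) auto
    also have "\<dots> = (D * c) * real l" by simp
    also have "\<dots> \<le> \<zeta> / 2 * real l" using c(3) by (intro mult_right_mono) auto
    finally have "\<bar>\<Psi> (a ?w) - \<Psi> ?w\<bar> \<le> \<zeta> / 2 * real l"
      using quasi_additive_edit_relpow[OF \<Psi> k(2)] by (simp add: D_def)
    moreover have "\<bar>birkhoff_sum f l y - \<Psi> ?w\<bar> \<le> \<epsilon> * real l + C"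
      using approximates_birkhoffD[OF approx cylinder_map_upt y(1), of l] by simp
    ultimately have "(\<beta> - \<epsilon> - \<zeta>) * real l \<le> \<Psi> (a ?w)"
      unfolding left_diff_distrib using y(2) elim(2) by linarith
    moreover have "\<bar>real (length (a ?w)) - real l\<bar> \<le> \<zeta> * real l"
    proof -
      have "\<bar>real (length (a ?w)) - real l\<bar> \<le> real (g l)"
        using edit_relpow_length[OF k(2)] k(1) by simp
      also have "\<dots> \<le> c * real l" by (rule elim(1))
      also have "\<dots> \<le> \<zeta> * real l" using c(2) by (intro mult_right_mono) auto
      finally show ?thesis .
    qed
    ultimately show ?case using aG[OF w] by blast
  qed
qed

section \<open>Avoiding a cover\<close>

text \<open>Only the part of \<open>y\<close> after \<open>P\<close> is weighed, so masses are
  normalised at the current prefix. An integral for the counting measure makes the exchange with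
  finite weighted sums an instance of linearity.\<close>

definition tail_mass :: "'a list set \<Rightarrow> ('a list \<Rightarrow> real) \<Rightarrow> 'a list \<Rightarrow> ennreal" where
  "tail_mass Y f P = (\<integral>\<^sup>+y. (if prefix P y then ennreal (f (drop (length P) y)) else 0) \<partial>count_space Y)"

text \<open>Cutting a gap and a word \<open>w\<close> off \<open>z\<close> changes the exponent of
  \<open>f\<close> by a controlled amount; of the gap only the length bound \<open>q\<close> is
  known, hence the rate \<open>\<bar>t\<bar> + B\<close>. At most \<open>card I\<close> words
  contribute, and \<open>large\<close> says that the total weight of \<open>W\<close> beats this
  number times the cost.\<close>

lemma sum_extensions_le:
  fixes t K :: real
  assumes qa: "quasi_additive C B \<Phi>" and W: "finite W" "\<And>w. w \<in> W \<Longrightarrow> length w = m"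
    and I: "finite I" "\<And>w. w \<in> W \<Longrightarrow> length (h w) \<in> I" "\<And>i. i \<in> I \<Longrightarrow> i \<le> q"
    and large: "real (card I) * exp (t * real m + 2 * C + (\<bar>t\<bar> + B) * real q) \<le> (\<Sum>w\<in>W. exp (\<Phi> w))"
    and f: "f = (\<lambda>z. exp (K - t * real (length z) + \<Phi> z))"
  shows "(\<Sum>w\<in>W. if prefix (h w @ w) z then exp (\<Phi> w) * f (drop (length (h w @ w)) z) else 0)
           \<le> (\<Sum>w\<in>W. exp (\<Phi> w)) * f z"
proof -
  let ?W = "{w \<in> W. prefix (h w @ w) z}"
  let ?E = "exp (t * real m + 2 * C + (\<bar>t\<bar> + B) * real q)"
  have term_le: "exp (\<Phi> w) * f (drop (length (h w @ w)) z) \<le> ?E * f z" if w: "w \<in> ?W" for w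
  proof -
    obtain r where r: "z = h w @ w @ r" using w by (auto simp: prefix_def)
    have hq: "real (length (h w)) \<le> real q" using w I by auto
    have m: "length w = m" using w W by auto
    have "\<Phi> w + \<Phi> r \<le> \<Phi> z + 2 * C + B * real (length (h w))"
      using quasi_additive_append[OF qa, of "h w" "w @ r"] quasi_additive_append[OF qa, of w r]
        quasi_additive_bound[OF qa, of "h w"] unfolding r by linarith
    also have "B * real (length (h w)) \<le> B * real q"
      using hq quasi_additive_nonneg(2)[OF qa] by (rule mult_left_mono)
    finally have "\<Phi> w + \<Phi> r \<le> \<Phi> z + 2 * C + B * real q" by simp
    moreover have "t * real (length (h w)) \<le> \<bar>t\<bar> * real q"
      using hq by (intro mult_mono) auto
    moreover have "t * real (length z) = t * real (length (h w)) + t * real m + t * real (length r)"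
      using m unfolding r by (simp add: algebra_simps)
    ultimately have "\<Phi> w + (K - t * real (length r) + \<Phi> r)
        \<le> (t * real m + 2 * C + (\<bar>t\<bar> + B) * real q) + (K - t * real (length z) + \<Phi> z)"
      by (simp add: algebra_simps)
    then show ?thesis unfolding f r by (simp flip: exp_add)
  qed
  \<comment> \<open>A contributing word is determined by \<open>z\<close> and its gap length.\<close>
  have "take m (drop (length (h w)) z) = w" if "w \<in> ?W" for w
    using that W(2)[of w] by (auto simp: prefix_def)
  then have "inj_on (\<lambda>w. length (h w)) ?W"
    by (intro inj_on_inverseI[where g = "\<lambda>i. take m (drop i z)"]) blast
  then have card: "card ?W \<le> card I"
    using I by (intro card_inj_on_le) auto
  have "(\<Sum>w\<in>W. if prefix (h w @ w) z then exp (\<Phi> w) * f (drop (length (h w @ w)) z) else 0)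
      = (\<Sum>w\<in>?W. exp (\<Phi> w) * f (drop (length (h w @ w)) z))"
    using W(1) by (intro sum.inter_filter[symmetric])
  also have "\<dots> \<le> (\<Sum>w\<in>?W. ?E * f z)" by (intro sum_mono term_le)
  also have "\<dots> = real (card ?W) * ?E * f z" by simp
  also have "\<dots> \<le> real (card I) * ?E * f z"
    using card by (intro mult_right_mono) (auto simp: f)
  also have "\<dots> \<le> (\<Sum>w\<in>W. exp (\<Phi> w)) * f z" using large by (intro mult_right_mono) (auto simp: f)
  finally show ?thesis .
qed

text \<open>The constant \<open>K\<close> pays for \<open>N\<close> letters at the rate
  \<open>\<bar>t\<bar> + B\<close>, so \<open>f\<close> is at least 1 on every word of length at
  most \<open>N\<close>. One such tail already fills the mass.\<close>

lemma tail_mass_less_1_imp_long: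
  fixes t K :: real
  assumes qa: "quasi_additive C B \<Phi>" and K: "(\<bar>t\<bar> + B) * real N \<le> K"
    and less: "tail_mass Y (\<lambda>z. exp (K - t * real (length z) + \<Phi> z)) P < 1"
    and y: "y \<in> Y" "prefix P y"
  shows "length P + N < length y"
proof (rule ccontr)
  let ?z = "drop (length P) y"
  assume "\<not> length P + N < length y"
  then have z: "real (length ?z) \<le> real N" by simp
  have "t * real (length ?z) \<le> \<bar>t\<bar> * real N" using z by (intro mult_mono) auto
  moreover have "- \<Phi> ?z \<le> B * real N"
    using quasi_additive_bound[OF qa, of ?z] mult_left_mono[OF z quasi_additive_nonneg(2)[OF qa]]
    by linarith
  ultimately have "0 \<le> K - t * real (length ?z) + \<Phi> ?z" using K by (simp add: algebra_simps)
  then have "(1::ennreal) \<le> (if prefix P y then ennreal (exp (K - t * real (length ?z) + \<Phi> ?z)) else 0)"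
    using y by simp
  also have "\<dots> \<le> tail_mass Y (\<lambda>z. exp (K - t * real (length z) + \<Phi> z)) P"
    unfolding tail_mass_def using y(1) by (rule nn_integral_ge_point)
  finally show False using less by simp
qed

text \<open>The average of the masses of the extensions of \<open>P\<close>, with weights \<open>exp (\<Phi> w)\<close>, is at most the
  mass of \<open>P\<close>.\<close>

lemma ex_extension_tail_mass_less_1:
  fixes t K :: real
  assumes qa: "quasi_additive C B \<Phi>" and W: "finite W" "W \<noteq> {}" "\<And>w. w \<in> W \<Longrightarrow> length w = m"
    and I: "finite I" "\<And>w. w \<in> W \<Longrightarrow> length (h w) \<in> I" "\<And>i. i \<in> I \<Longrightarrow> i \<le> q"
    and large: "real (card I) * exp (t * real m + 2 * C + (\<bar>t\<bar> + B) * real q) \<le> (\<Sum>w\<in>W. exp (\<Phi> w))"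
    and f: "f = (\<lambda>z. exp (K - t * real (length z) + \<Phi> z))"
    and less: "tail_mass Y f P < 1"
  shows "\<exists>w\<in>W. tail_mass Y f (P @ h w @ w) < 1"
proof (rule ccontr)
  assume "\<not> ?thesis"
  then have ge: "1 \<le> tail_mass Y f (P @ h w @ w)" if "w \<in> W" for w using that by (simp add: not_less)
  let ?Z = "\<Sum>w\<in>W. exp (\<Phi> w)"
  let ?g = "\<lambda>P y. if prefix P y then ennreal (f (drop (length P) y)) else 0"
  have Zpos: "?Z > 0" using W by (intro sum_pos) auto
  have fpos: "f z \<ge> 0" for z by (simp add: f)
  \<comment> \<open>The averaging inequality holds for each cover element separately; elements not
    extending \<open>P\<close> vanish on both sides.\<close>
  have pointwise: "(\<Sum>w\<in>W. ennreal (exp (\<Phi> w)) * ?g (P @ h w @ w) y) \<le> ennreal ?Z * ?g P y" for y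
  proof (cases "prefix P y")
    case False
    then have "\<not> prefix (P @ x) y" for x by (auto simp: prefix_def)
    then show ?thesis by simp
  next
    case True
    then obtain z where y: "y = P @ z" by (auto simp: prefix_def)
    have "(\<Sum>w\<in>W. ennreal (exp (\<Phi> w)) * ?g (P @ h w @ w) y)
        = (\<Sum>w\<in>W. ennreal (if prefix (h w @ w) z then exp (\<Phi> w) * f (drop (length (h w @ w)) z) else 0))"
      unfolding y by (intro sum.cong) (auto simp: ennreal_mult fpos)
    also have "\<dots> = ennreal (\<Sum>w\<in>W. if prefix (h w @ w) z then exp (\<Phi> w) * f (drop (length (h w @ w)) z) else 0)"
      using fpos by (intro sum_ennreal) auto
    also have "\<dots> \<le> ennreal (?Z * f z)"
      by (intro ennreal_leI sum_extensions_le[OF qa W(1,3) I large f])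
    also have "\<dots> = ennreal ?Z * ?g P y"
      unfolding y using Zpos fpos by (simp add: ennreal_mult)
    finally show ?thesis .
  qed
  have "ennreal ?Z = (\<Sum>w\<in>W. ennreal (exp (\<Phi> w)) * 1)" by (simp add: sum_ennreal)
  also have "\<dots> \<le> (\<Sum>w\<in>W. ennreal (exp (\<Phi> w)) * tail_mass Y f (P @ h w @ w))"
    using ge by (intro sum_mono mult_left_mono) auto
  also have "\<dots> = (\<integral>\<^sup>+y. (\<Sum>w\<in>W. ennreal (exp (\<Phi> w)) * ?g (P @ h w @ w) y) \<partial>count_space Y)"
    unfolding tail_mass_def by (subst nn_integral_sum) (auto simp: nn_integral_cmult)
  also have "\<dots> \<le> (\<integral>\<^sup>+y. ennreal ?Z * ?g P y \<partial>count_space Y)"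
    by (intro nn_integral_mono pointwise)
  also have "\<dots> = ennreal ?Z * tail_mass Y f P"
    unfolding tail_mass_def by (intro nn_integral_cmult) simp
  also have "\<dots> < ennreal ?Z * 1"
    using less Zpos by (intro ennreal_mult_strict_left_mono) auto
  finally show False by simp
qed

lemma ex_limit_of_prefix_chain:
  fixes P :: "nat \<Rightarrow> nat list"
  assumes "\<And>i. prefix (P i) (P (Suc i))" "\<And>i. length (P i) < length (P (Suc i))"
  obtains x where "\<And>i. x \<in> cylinder (P i)"
proof -
  have pre: "prefix (P i) (P j)" if "i \<le> j" for i j
    using that assms(1) prefix_order.lift_Suc_mono_le by blast
  have len: "i \<le> length (P i)" for i
  proof (induction i)
    case (Suc i)
    then show ?case using assms(2)[of i] by simp
  qed simp
  \<comment> \<open>The index \<open>Suc n\<close> ensures that the prefix has more than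
    \<open>n\<close> letters.\<close>
  define x where "x n = P (Suc n) ! n" for n
  have "x \<in> cylinder (P i)" for i
    unfolding cylinder_def
  proof (intro CollectI allI impI)
    fix n assume n: "n < length (P i)"
    have n': "n < length (P (Suc n))" using len[of "Suc n"] by simp
    from pre[of i "Suc n"] pre[of "Suc n" i] show "x n = P i ! n"
      unfolding x_def using n n' by (cases "i \<le> Suc n") (auto simp: prefix_def nth_append)
  qed
  then show ?thesis by (rule that)
qed

text \<open>The filler is treated as part of the gap, which is thus \<open>u\<close> or
  \<open>u @ v @ u'\<close>. Whatever the length of \<open>v\<close>, the gap length takes at most
  \<open>2 * \<tau> + 1\<close> values; the length of \<open>v\<close> enters only through the
  exponent in \<open>large\<close>.\<close>

lemma ex_specification_path:
  fixes t K :: real and T :: "nat \<Rightarrow> bool"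
  assumes spec: "\<And>v w. v \<in> G \<Longrightarrow> w \<in> G \<Longrightarrow> \<exists>u. length u \<le> \<tau> \<and> v @ u @ w \<in> G"
    and qa: "quasi_additive C B \<Phi>"
    and W: "finite W" "W \<noteq> {}" "W \<subseteq> G" "\<And>w. w \<in> W \<Longrightarrow> length w = m"
    and v: "v \<in> G" and P0: "P0 \<in> G"
    and large: "real (2 * \<tau> + 1) * exp (t * real m + 2 * C + (\<bar>t\<bar> + B) * real (2 * \<tau> + length v))
      \<le> (\<Sum>w\<in>W. exp (\<Phi> w))"
    and f: "f = (\<lambda>z. exp (K - t * real (length z) + \<Phi> z))"
    and less: "tail_mass Y f P0 < 1"
  shows "\<exists>P. P 0 = P0 \<and> (\<forall>i. P i \<in> G \<and> tail_mass Y f (P i) < 1 \<and>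
    (if T i then \<exists>u u' w. P (Suc i) = P i @ u @ v @ u' @ w \<and> w \<in> W \<and> length u \<le> \<tau> \<and> length u' \<le> \<tau>
     else \<exists>u w. P (Suc i) = P i @ u @ w \<and> w \<in> W \<and> length u \<le> \<tau>))"
proof -
  let ?q = "2 * \<tau> + length v"
  define good where "good b Q R \<longleftrightarrow>
    (if b then \<exists>u u' w. R = Q @ u @ v @ u' @ w \<and> w \<in> W \<and> length u \<le> \<tau> \<and> length u' \<le> \<tau>
     else \<exists>u w. R = Q @ u @ w \<and> w \<in> W \<and> length u \<le> \<tau>)" for b Q R
  have step: "\<exists>R. R \<in> G \<and> tail_mass Y f R < 1 \<and> good b Q R" if Q: "Q \<in> G" "tail_mass Y f Q < 1" for Q b
  proof -
    define I where "I = (if b then {length v..length v + 2 * \<tau>} else {0..\<tau>})"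
    have "\<exists>h. length h \<in> I \<and> Q @ h @ w \<in> G \<and> good b Q (Q @ h @ w)" if w: "w \<in> W" for w
    proof (cases b)
      case True
      obtain u where u: "length u \<le> \<tau>" "Q @ u @ v \<in> G" using spec[OF Q(1) v] by blast
      obtain u' where u': "length u' \<le> \<tau>" "(Q @ u @ v) @ u' @ w \<in> G" using spec[OF u(2)] w W(3) by blast
      show ?thesis
        using True u u' w by (intro exI[of _ "u @ v @ u'"]) (auto simp: I_def good_def)
    next
      case False
      obtain u where u: "length u \<le> \<tau>" "Q @ u @ w \<in> G" using spec[OF Q(1)] w W(3) by blast
      show ?thesis
        using False u w by (intro exI[of _ u]) (auto simp: I_def good_def)
    qed
    then obtain h where h: "\<And>w. w \<in> W \<Longrightarrow> length (h w) \<in> I" "\<And>w. w \<in> W \<Longrightarrow> Q @ h w @ w \<in> G"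
      "\<And>w. w \<in> W \<Longrightarrow> good b Q (Q @ h w @ w)" by metis
    have I: "finite I" "\<And>i. i \<in> I \<Longrightarrow> i \<le> ?q" "card I \<le> 2 * \<tau> + 1"
      by (auto simp: I_def split: if_splits)
    have "real (card I) * exp (t * real m + 2 * C + (\<bar>t\<bar> + B) * real ?q)
        \<le> real (2 * \<tau> + 1) * exp (t * real m + 2 * C + (\<bar>t\<bar> + B) * real ?q)"
      using I(3) by (intro mult_right_mono) (simp_all only: of_nat_le_iff exp_ge_zero)
    also note large
    finally have large': "real (card I) * exp (t * real m + 2 * C + (\<bar>t\<bar> + B) * real ?q)
      \<le> (\<Sum>w\<in>W. exp (\<Phi> w))" .
    have "\<exists>w\<in>W. tail_mass Y f (Q @ h w @ w) < 1"
      by (rule ex_extension_tail_mass_less_1[OF qa W(1,2,4) I(1) h(1) I(2) large' f Q(2)])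
    then show ?thesis using h by blast
  qed
  have "\<exists>P. \<forall>i. (P i \<in> G \<and> tail_mass Y f (P i) < 1 \<and> (i = 0 \<longrightarrow> P i = P0)) \<and> good (T i) (P i) (P (Suc i))"
  proof (rule dependent_nat_choice)
    show "\<exists>Q. Q \<in> G \<and> tail_mass Y f Q < 1 \<and> ((0::nat) = 0 \<longrightarrow> Q = P0)" using P0 less by blast
    fix Q and n :: nat
    assume "Q \<in> G \<and> tail_mass Y f Q < 1 \<and> (n = 0 \<longrightarrow> Q = P0)"
    then show "\<exists>R. (R \<in> G \<and> tail_mass Y f R < 1 \<and> (Suc n = 0 \<longrightarrow> R = P0)) \<and> good (T n) Q R"
      using step[of Q "T n"] by auto
  qed
  then show ?thesis unfolding good_def by metis
qed

text \<open>If \<open>x\<close> lay in the cylinder of \<open>y\<close>, every \<open>P i\<close>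
  would be a prefix of \<open>y\<close>: mass below 1 keeps \<open>y\<close> more than
  \<open>N\<close> letters longer than \<open>P i\<close>, and a step adds at most \<open>N\<close>.
  But the \<open>P i\<close> become arbitrarily long.\<close>

lemma limit_avoids_cover:
  fixes t K :: real and P :: "nat \<Rightarrow> nat list"
  assumes qa: "quasi_additive C B \<Phi>" and K: "(\<bar>t\<bar> + B) * real N \<le> K"
    and less: "\<And>i. tail_mass Y (\<lambda>z. exp (K - t * real (length z) + \<Phi> z)) (P i) < 1"
    and x: "\<And>i. x \<in> cylinder (P i)"
    and len: "\<And>i. length (P i) < length (P (Suc i))" "\<And>i. length (P (Suc i)) \<le> length (P i) + N"
    and y: "y \<in> Y" "length (P 0) \<le> length y"
  shows "x \<notin> cylinder y"
proof
  assume xy: "x \<in> cylinder y"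
  have pre: "prefix (P i) y" if "length (P i) \<le> length y" for i
  proof -
    have "P i = take (length (P i)) y"
      using x[of i] xy that by (intro nth_equalityI) (auto simp: cylinder_def)
    then show ?thesis by (metis take_is_prefix)
  qed
  have "length (P i) \<le> length y" for i
  proof (induction i)
    case (Suc i)
    have "length (P i) + N < length y"
      by (rule tail_mass_less_1_imp_long[OF qa K less y(1) pre[OF Suc]])
    then show ?case using len(2)[of i] by simp
  qed (rule y(2))
  moreover have "i \<le> length (P i)" for i
  proof (induction i)
    case (Suc i)
    then show ?case using len(1)[of i] by simp
  qed simp
  ultimately have "Suc (length y) \<le> length y" using le_trans by blast
  then show False by simp
qed

section \<open>Irregular points avoiding a cover\<close>

text \<open>The slope \<open>r\<close> is read off on windows from \<open>j\<close> to
  \<open>2 * j\<close>. For \<open>j = 4 ^ k\<close> every step inserts, which forces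
  \<open>r\<close> to be about \<open>b / \<Lambda>\<close> or more; for
  \<open>j = 2 * 4 ^ k\<close> none does, and a nonnegative \<open>r\<close> is about
  \<open>a / \<mu>\<close> at most. A window is as long as its past, so the error
  \<open>\<omega> * n\<close> stays proportional to the window.\<close>

lemma not_asymptotically_linear:
  fixes D n :: "nat \<Rightarrow> real"
  assumes T: "\<And>i. T i \<longleftrightarrow> (\<exists>k. 4 ^ k \<le> i \<and> i < 2 * 4 ^ k)"
    and up: "\<And>i. T i \<Longrightarrow> b \<le> D (Suc i) - D i"
    and flat: "\<And>i. \<not> T i \<Longrightarrow> D (Suc i) - D i \<le> a"
    and n: "\<And>i. \<mu> \<le> n (Suc i) - n i" "\<And>i. n (Suc i) - n i \<le> \<Lambda>"
    and pos: "\<mu> > 0" "a \<ge> 0" "\<omega> \<ge> 0"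
    and lin: "\<forall>\<^sub>F i in sequentially. \<bar>D i - r * n i\<bar> \<le> \<omega> * n i"
  shows "b \<le> 4 * \<omega> * \<Lambda> + \<Lambda> / \<mu> * (a + 4 * \<omega> * \<Lambda>)"
proof -
  have \<Lambda>: "\<Lambda> > 0" using n(1)[of 0] n(2)[of 0] pos(1) by linarith
  have n_le: "n i \<le> n 0 + \<Lambda> * real i" for i
  proof (induction i)
    case (Suc i)
    then show ?case using n(2)[of i] by (simp add: algebra_simps)
  qed simp
  have n_diff_ge: "\<mu> * real d \<le> n (i + d) - n i" for i d
  proof (induction d)
    case (Suc d)
    then show ?case using n(1)[of "i + d"] by (simp add: algebra_simps)
  qed simp
  have n_diff_le: "n (i + d) - n i \<le> \<Lambda> * real d" for i d
  proof (induction d)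
    case (Suc d)
    then show ?case using n(2)[of "i + d"] by (simp add: algebra_simps)
  qed simp
  obtain N where N: "\<And>i. i \<ge> N \<Longrightarrow> \<bar>D i - r * n i\<bar> \<le> \<omega> * n i"
    using lin by (auto simp: eventually_sequentially)
  have "\<forall>\<^sub>F k in sequentially. 2 * \<bar>n 0\<bar> \<le> \<Lambda> * 4 ^ k" using \<Lambda> by real_asymp
  moreover have "\<forall>\<^sub>F k in sequentially. real N \<le> 4 ^ k" by real_asymp
  ultimately have "\<forall>\<^sub>F k in sequentially. 2 * \<bar>n 0\<bar> \<le> \<Lambda> * 4 ^ k \<and> real N \<le> 4 ^ k"
    by (rule eventually_conj)
  then obtain k where k: "2 * \<bar>n 0\<bar> \<le> \<Lambda> * 4 ^ k" "real N \<le> 4 ^ k"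
    by (auto simp: eventually_sequentially)
  define i where "i = (4::nat) ^ k"
  have ri: "real i = 4 ^ k" by (simp add: i_def)
  have i: "i \<ge> N" "2 * \<bar>n 0\<bar> \<le> \<Lambda> * real i" "real i > 0"
  proof -
    have "real N \<le> real i" using k(2) ri by simp
    then show "i \<ge> N" by simp
  qed (use k ri in auto)
  have osc: "r * (n (j + j) - n j) - 4 * \<omega> * \<Lambda> * real j \<le> D (j + j) - D j"
    "D (j + j) - D j \<le> r * (n (j + j) - n j) + 4 * \<omega> * \<Lambda> * real j" if j: "j \<ge> i" for j
  proof -
    \<comment> \<open>The two ends have lengths summing to at most
      \<open>2 * n 0 + 3 * \<Lambda> * j\<close>; the fourth \<Lambda> absorbs the initial
      length.\<close>
    have "\<Lambda> * real i \<le> \<Lambda> * real j" using j \<Lambda> by (intro mult_left_mono) auto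
    then have "n j + n (j + j) \<le> 4 * \<Lambda> * real j"
      using n_le[of j] n_le[of "j + j"] i(2) by (simp add: algebra_simps)
    then have "\<omega> * (n j + n (j + j)) \<le> \<omega> * (4 * \<Lambda> * real j)"
      using pos(3) by (rule mult_left_mono)
    moreover have "\<bar>D j - r * n j\<bar> \<le> \<omega> * n j" "\<bar>D (j + j) - r * n (j + j)\<bar> \<le> \<omega> * n (j + j)"
      using i(1) j by (auto intro!: N)
    ultimately show "r * (n (j + j) - n j) - 4 * \<omega> * \<Lambda> * real j \<le> D (j + j) - D j"
      "D (j + j) - D j \<le> r * (n (j + j) - n j) + 4 * \<omega> * \<Lambda> * real j"
      by (auto simp: algebra_simps abs_le_iff)
  qed
  have "b * real d \<le> D (i + d) - D i" if "d \<le> i" for d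
    using that
  proof (induction d)
    case (Suc d)
    have "T (i + d)" unfolding T using Suc.prems by (intro exI[of _ k]) (auto simp: i_def)
    then show ?case using up[of "i + d"] Suc by (simp add: algebra_simps)
  qed simp
  from this[of i] have up': "b * real i \<le> r * (n (i + i) - n i) + 4 * \<omega> * \<Lambda> * real i"
    using osc(2)[of i] by simp
  let ?j = "i + i"
  have "D (?j + d) - D ?j \<le> a * real d" if "d \<le> ?j" for d
    using that
  proof (induction d)
    case (Suc d)
    \<comment> \<open>The next insertion period starts only at \<open>4 ^ Suc k\<close>, where this
      window ends.\<close>
    have "\<not> T (?j + d)"
    proof
      assume "T (?j + d)"
      then obtain l where l: "4 ^ l \<le> ?j + d" "?j + d < 2 * 4 ^ l" unfolding T by blast
      have "(4::nat) ^ k < 4 ^ l" using l(2) unfolding i_def by linarith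
      then have "Suc k \<le> l" by (simp add: Suc_le_eq)
      then have "(4::nat) ^ Suc k \<le> 4 ^ l" by (intro power_increasing) auto
      then show False using l(1) Suc.prems by (simp add: i_def)
    qed
    then show ?case using flat[of "?j + d"] Suc by (simp add: algebra_simps)
  qed simp
  from this[of ?j] have flat': "r * (n (?j + ?j) - n ?j) \<le> (a + 4 * \<omega> * \<Lambda>) * real ?j"
    using osc(1)[of ?j] by (simp add: algebra_simps)
  show ?thesis
  proof (cases "r \<ge> 0")
    case True
    have "r * (\<mu> * real ?j) \<le> r * (n (?j + ?j) - n ?j)"
      using n_diff_ge True by (rule mult_left_mono)
    then have "(r * \<mu>) * real ?j \<le> (a + 4 * \<omega> * \<Lambda>) * real ?j" using flat' by (simp add: mult.assoc)
    then have "r * \<mu> \<le> a + 4 * \<omega> * \<Lambda>" using i(3) by (simp add: mult_le_cancel_right)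
    then have r: "r \<le> (a + 4 * \<omega> * \<Lambda>) / \<mu>" using pos(1) by (simp add: pos_le_divide_eq)
    have "r * (n (i + i) - n i) \<le> r * (\<Lambda> * real i)"
      using n_diff_le True by (rule mult_left_mono)
    then have "b * real i \<le> (r * \<Lambda> + 4 * \<omega> * \<Lambda>) * real i" using up' by (simp add: algebra_simps)
    then have "b \<le> r * \<Lambda> + 4 * \<omega> * \<Lambda>" using i(3) by (simp add: mult_le_cancel_right)
    moreover have "r * \<Lambda> \<le> (a + 4 * \<omega> * \<Lambda>) / \<mu> * \<Lambda>" using r \<Lambda> by (intro mult_right_mono) auto
    ultimately show ?thesis by (simp add: field_simps)
  next
    case False
    have "0 \<le> \<mu> * real i" using pos(1) by simp
    then have "0 \<le> n (i + i) - n i" using n_diff_ge[of i i] by linarith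
    then have "r * (n (i + i) - n i) \<le> 0" using False by (intro mult_nonpos_nonneg) auto
    then have "b * real i \<le> (4 * \<omega> * \<Lambda>) * real i" using up' by simp
    then have "b \<le> 4 * \<omega> * \<Lambda>" using i(3) by (simp add: mult_le_cancel_right)
    moreover have "0 \<le> \<Lambda> / \<mu> * (a + 4 * \<omega> * \<Lambda>)" using \<Lambda> pos by simp
    ultimately show ?thesis by linarith
  qed
qed

text \<open>Recentring at \<gamma> makes the words of \<open>W\<close> nearly neutral, so that only
  fillers move the functional appreciably.\<close>

lemma quasi_additive_minus_linear:
  assumes "quasi_additive C B \<Psi>" "\<bar>\<gamma>\<bar> \<le> B"
  shows "quasi_additive C (2 * B) (\<lambda>w. \<Psi> w - \<gamma> * real (length w))"
proof -
  have "\<bar>\<Psi> w - \<gamma> * real (length w)\<bar> \<le> 2 * B * real (length w)" for w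
  proof -
    have "\<bar>\<gamma> * real (length w)\<bar> \<le> B * real (length w)"
      using assms(2) by (simp add: abs_mult mult_right_mono)
    then show ?thesis using quasi_additive_bound[OF assms(1), of w] by linarith
  qed
  moreover have "\<bar>\<Psi> (u @ v) - \<gamma> * real (length (u @ v)) - (\<Psi> u - \<gamma> * real (length u))
      - (\<Psi> v - \<gamma> * real (length v))\<bar> \<le> C" for u v
    using quasi_additive_append[OF assms(1), of u v] by (simp add: algebra_simps)
  ultimately show ?thesis using quasi_additive_nonneg[OF assms(1)] by (simp add: quasi_additive_def)
qed

text \<open>The numerical hypotheses record the errors of one step for the recentred functional. In
  \<open>flat\<close> they are one word of \<open>W\<close>, one gap and two concatenations; in
  \<open>up\<close>, one word of \<open>W\<close>, two gaps and four concatenations, against the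
  gain from the filler. The condition \<open>gap\<close> contradicts convergence of the
  averages.\<close>

lemma ex_irregular_point_avoiding:
  fixes t \<gamma> a b e \<epsilon> \<mu> \<Lambda> K :: real
  assumes X: "shift_space p X" and G: "G \<subseteq> language X"
    and spec: "\<And>v w. v \<in> G \<Longrightarrow> w \<in> G \<Longrightarrow> \<exists>u. length u \<le> \<tau> \<and> v @ u @ w \<in> G"
    and \<Phi>: "quasi_additive C B \<Phi>"
    and \<Psi>: "quasi_additive C' B' \<Psi>" "approximates_birkhoff X \<psi> \<epsilon> C' \<Psi>" "\<epsilon> > 0"
    and W: "finite W" "W \<noteq> {}" "W \<subseteq> G" "\<And>w. w \<in> W \<Longrightarrow> length w = m"
      "\<And>w. w \<in> W \<Longrightarrow> \<bar>\<Psi> w - \<gamma> * real m\<bar> \<le> e" "\<bar>\<gamma>\<bar> \<le> B'"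
    and v: "v \<in> G" and P0: "P0 \<in> G"
    and large: "real (2 * \<tau> + 1) * exp (t * real m + 2 * C + (\<bar>t\<bar> + B) * real (2 * \<tau> + length v))
      \<le> (\<Sum>w\<in>W. exp (\<Phi> w))"
    and K: "(\<bar>t\<bar> + B) * real (2 * \<tau> + length v + m) \<le> K"
    and flat: "e + 2 * B' * real \<tau> + 2 * C' \<le> a"
    and up: "b + e + 4 * B' * real \<tau> + 4 * C' \<le> \<Psi> v - \<gamma> * real (length v)"
    and len: "0 < \<mu>" "\<mu> \<le> real m" "real (2 * \<tau> + length v + m) \<le> \<Lambda>"
    and gap: "12 * \<epsilon> * \<Lambda> + \<Lambda> / \<mu> * (a + 12 * \<epsilon> * \<Lambda>) < b"
    and less: "tail_mass Y (\<lambda>z. exp (K - t * real (length z) + \<Phi> z)) P0 < 1"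
    and Y: "\<And>y. y \<in> Y \<Longrightarrow> length P0 \<le> length y"
  shows "\<exists>x\<in>irregular_set X \<psi>. \<forall>y\<in>Y. x \<notin> cylinder y"
proof -
  define T :: "nat \<Rightarrow> bool" where "T i \<longleftrightarrow> (\<exists>k. 4 ^ k \<le> i \<and> i < 2 * 4 ^ k)" for i
  define N where "N = 2 * \<tau> + length v + m"
  have "\<exists>P. P 0 = P0 \<and> (\<forall>i. P i \<in> G \<and>
      tail_mass Y (\<lambda>z. exp (K - t * real (length z) + \<Phi> z)) (P i) < 1 \<and>
      (if T i then \<exists>u u' w. P (Suc i) = P i @ u @ v @ u' @ w \<and> w \<in> W \<and> length u \<le> \<tau> \<and> length u' \<le> \<tau>
       else \<exists>u w. P (Suc i) = P i @ u @ w \<and> w \<in> W \<and> length u \<le> \<tau>))"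
    by (rule ex_specification_path[OF _ \<Phi> W(1-3) _ v P0 large refl less]) (fact spec, fact W(4))
  then obtain P where P: "P 0 = P0" and P': "\<forall>i. P i \<in> G \<and>
      tail_mass Y (\<lambda>z. exp (K - t * real (length z) + \<Phi> z)) (P i) < 1 \<and>
      (if T i then \<exists>u u' w. P (Suc i) = P i @ u @ v @ u' @ w \<and> w \<in> W \<and> length u \<le> \<tau> \<and> length u' \<le> \<tau>
       else \<exists>u w. P (Suc i) = P i @ u @ w \<and> w \<in> W \<and> length u \<le> \<tau>)"
    by blast
  have PG: "P i \<in> G" and Pless: "tail_mass Y (\<lambda>z. exp (K - t * real (length z) + \<Phi> z)) (P i) < 1" for i
    using P' by blast+
  have PT: "\<exists>u u' w. P (Suc i) = P i @ u @ v @ u' @ w \<and> w \<in> W \<and> length u \<le> \<tau> \<and> length u' \<le> \<tau>"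
    if "T i" for i using P'[rule_format, of i] that by simp
  have PF: "\<exists>u w. P (Suc i) = P i @ u @ w \<and> w \<in> W \<and> length u \<le> \<tau>"
    if "\<not> T i" for i using P'[rule_format, of i] that by simp
  have step: "prefix (P i) (P (Suc i)) \<and> length (P i) + m \<le> length (P (Suc i)) \<and>
      length (P (Suc i)) \<le> length (P i) + N" for i
  proof (cases "T i")
    case True
    then show ?thesis using PT[of i] W(4) by (auto simp: N_def)
  next
    case False
    then show ?thesis using PF[of i] W(4) by (auto simp: N_def)
  qed
  have "m > 0" using len by (cases m) auto
  have len_less: "length (P i) < length (P (Suc i))" for i using step[of i] \<open>m > 0\<close> by linarith
  have len_ge: "i \<le> length (P i)" for i
  proof (induction i)
    case (Suc i)
    then show ?case using len_less[of i] by simp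
  qed simp
  obtain x where x: "\<And>i. x \<in> cylinder (P i)"
    using ex_limit_of_prefix_chain[of P] step len_less by blast
  have avoid: "x \<notin> cylinder y" if "y \<in> Y" for y
  proof (rule limit_avoids_cover[where P = P and N = N and Y = Y])
    show "quasi_additive C B \<Phi>" by (rule \<Phi>)
    show "tail_mass Y (\<lambda>z. exp (K - t * real (length z) + \<Phi> z)) (P i) < 1" for i by (rule Pless)
    show "x \<in> cylinder (P i)" "length (P i) < length (P (Suc i))" for i by (rule x, rule len_less)
    show "(\<bar>t\<bar> + B) * real N \<le> K" using K by (simp add: N_def)
    show "length (P (Suc i)) \<le> length (P i) + N" for i using step by blast
    show "y \<in> Y" "length (P 0) \<le> length y" using that Y P by auto
  qed
  have xX: "x \<in> X"
  proof (rule mem_shift_space_limit[OF X])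
    fix n
    obtain z where z: "z \<in> cylinder (P n)" "z \<in> X" using PG[of n] G by (auto simp: language_def)
    have "map x [0..<n] = map z [0..<n]"
      using x[of n] z(1) len_ge[of n] by (auto simp: cylinder_def)
    then show "map x [0..<n] \<in> language X" using language_map_upt[OF z(2), of n] by (simp only:)
  qed
  have "\<not> convergent (\<lambda>n. birkhoff_sum \<psi> n x / real n)"
  proof
    assume "convergent (\<lambda>n. birkhoff_sum \<psi> n x / real n)"
    then obtain L where L: "(\<lambda>n. birkhoff_sum \<psi> n x / real n) \<longlonglongrightarrow> L" by (auto simp: convergent_def)
    have "\<forall>\<^sub>F n in sequentially. \<bar>birkhoff_sum \<psi> n x / real n - L\<bar> < \<epsilon>"
      using tendstoD[OF L \<Psi>(3)] by (simp add: dist_real_def)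
    moreover have "\<forall>\<^sub>F n in sequentially. C' \<le> \<epsilon> * real n" using \<Psi>(3) by real_asymp
    ultimately have "\<forall>\<^sub>F n in sequentially. \<bar>birkhoff_sum \<psi> n x - L * real n\<bar> \<le> \<epsilon> * real n \<and> C' \<le> \<epsilon> * real n"
      using eventually_gt_at_top[of 0]
    proof eventually_elim
      case (elim n)
      have "\<bar>birkhoff_sum \<psi> n x - L * real n\<bar> = \<bar>birkhoff_sum \<psi> n x / real n - L\<bar> * real n"
        using elim(3) by (simp add: field_simps flip: abs_mult_pos)
      also have "\<dots> \<le> \<epsilon> * real n" using elim(1) by (intro mult_right_mono) auto
      finally show ?case using elim(2) by simp
    qed
    moreover have "filterlim (\<lambda>i. length (P i)) sequentially sequentially"
      by (rule filterlim_at_top_mono[OF filterlim_ident]) (use len_ge in auto)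
    ultimately have ev: "\<forall>\<^sub>F i in sequentially. \<bar>birkhoff_sum \<psi> (length (P i)) x - L * real (length (P i))\<bar>
        \<le> \<epsilon> * real (length (P i)) \<and> C' \<le> \<epsilon> * real (length (P i))"
      by (rule eventually_compose_filterlim)
    define \<Delta> where "\<Delta> w = \<Psi> w - \<gamma> * real (length w)" for w
    have \<Delta>: "quasi_additive C' (2 * B') \<Delta>"
      unfolding \<Delta>_def using quasi_additive_minus_linear[OF \<Psi>(1) W(6)] .
    have \<Delta>W: "\<bar>\<Delta> w\<bar> \<le> e" if "w \<in> W" for w using W(4,5) that by (simp add: \<Delta>_def)
    have \<Delta>u: "\<bar>\<Delta> u\<bar> \<le> 2 * B' * real \<tau>" if "length u \<le> \<tau>" for u
    proof -
      have "\<bar>\<Delta> u\<bar> \<le> 2 * B' * real (length u)" using \<Delta> by (rule quasi_additive_bound)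
      also have "\<dots> \<le> 2 * B' * real \<tau>"
        using that quasi_additive_nonneg[OF \<Psi>(1)] by (intro mult_left_mono) auto
      finally show ?thesis .
    qed
    \<comment> \<open>Of the \<open>3 * \<epsilon>\<close>, one part comes from the assumed
      convergence, one from approximating the Birkhoff sum, one from the constant
      \<open>C'\<close>.\<close>
    have "b \<le> 4 * (3 * \<epsilon>) * \<Lambda> + \<Lambda> / \<mu> * (a + 4 * (3 * \<epsilon>) * \<Lambda>)"
    proof (rule not_asymptotically_linear[where D = "\<lambda>i. \<Delta> (P i)" and n = "\<lambda>i. real (length (P i))"
          and r = "L - \<gamma>" and T = T])
      show "T i \<longleftrightarrow> (\<exists>k. 4 ^ k \<le> i \<and> i < 2 * 4 ^ k)" for i by (simp add: T_def)
      show "b \<le> \<Delta> (P (Suc i)) - \<Delta> (P i)" if Ti: "T i" for i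
      proof -
        obtain u u' w where s: "P (Suc i) = P i @ u @ v @ u' @ w" "w \<in> W" "length u \<le> \<tau>" "length u' \<le> \<tau>"
          using PT[OF Ti] by blast
        show ?thesis
          using quasi_additive_append[OF \<Delta>, of "P i" "u @ v @ u' @ w"]
            quasi_additive_append[OF \<Delta>, of u "v @ u' @ w"] quasi_additive_append[OF \<Delta>, of v "u' @ w"]
            quasi_additive_append[OF \<Delta>, of u' w] \<Delta>u[OF s(3)] \<Delta>u[OF s(4)] \<Delta>W[OF s(2)] up
          unfolding s(1) \<Delta>_def[of v] by linarith
      qed
      show "\<Delta> (P (Suc i)) - \<Delta> (P i) \<le> a" if Ti: "\<not> T i" for i
      proof -
        obtain u w where s: "P (Suc i) = P i @ u @ w" "w \<in> W" "length u \<le> \<tau>"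
          using PF[OF Ti] by blast
        show ?thesis
          using quasi_additive_append[OF \<Delta>, of "P i" "u @ w"] quasi_additive_append[OF \<Delta>, of u w]
            \<Delta>u[OF s(3)] \<Delta>W[OF s(2)] flat
          unfolding s(1) by linarith
      qed
      show "\<mu> \<le> real (length (P (Suc i))) - real (length (P i))" for i
        using step[of i] len(2) by linarith
      show "real (length (P (Suc i))) - real (length (P i)) \<le> \<Lambda>" for i
        using step[of i] len(3) unfolding N_def by linarith
      obtain w where "w \<in> W" using W(2) by blast
      have "0 \<le> e" "0 \<le> B' * real \<tau>" "0 \<le> C'"
        using \<Delta>W[OF \<open>w \<in> W\<close>] quasi_additive_nonneg[OF \<Psi>(1)] by auto
      then show "a \<ge> 0" using flat by linarith
      show "\<mu> > 0" by (rule len(1))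
      show "3 * \<epsilon> \<ge> 0" using \<Psi>(3) by simp
      show "\<forall>\<^sub>F i in sequentially. \<bar>\<Delta> (P i) - (L - \<gamma>) * real (length (P i))\<bar> \<le> 3 * \<epsilon> * real (length (P i))"
        using ev
      proof eventually_elim
        case (elim i)
        have "\<bar>birkhoff_sum \<psi> (length (P i)) x - \<Psi> (P i)\<bar> \<le> \<epsilon> * real (length (P i)) + C'"
          using approximates_birkhoffD[OF \<Psi>(2) x xX] .
        then show ?case using elim unfolding \<Delta>_def left_diff_distrib by linarith
      qed
    qed
    then show False using gap by simp
  qed
  with xX avoid show ?thesis by (auto simp: irregular_set_def)
qed

section \<open>From cheap covers of the irregular set to the pressure of the whole space\<close>

text \<open>This links the counting integral of \<open>tail_mass\<close> to the infinite sum in the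
  definition of pressure.\<close>

lemma nn_integral_le_infsum:
  fixes f :: "'a \<Rightarrow> ennreal"
  assumes "countable Y"
  shows "(\<integral>\<^sup>+y. f y \<partial>count_space Y) \<le> infsum f Y"
proof (cases "finite Y")
  case True
  then show ?thesis by (simp add: nn_integral_count_space_finite)
next
  case False
  let ?h = "from_nat_into Y"
  have bij: "bij_betw ?h UNIV Y" using assms False by (rule bij_betw_from_nat_into)
  have "(\<integral>\<^sup>+y. f y \<partial>count_space Y) = (\<integral>\<^sup>+n. f (?h n) \<partial>count_space UNIV)"
    using nn_integral_bij_count_space[OF bij, of f] by simp
  also have "\<dots> = (\<Sum>n. f (?h n))" by (rule nn_integral_count_space_nat)
  also have "\<dots> \<le> infsum f Y"
  proof (rule suminf_le_const)
    fix n
    have "(\<Sum>i<n. f (?h i)) = sum f (?h ` {..<n})"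
      using bij by (subst sum.reindex) (auto simp: bij_betw_def intro: inj_on_subset)
    also have "\<dots> \<le> infsum f Y"
      using bij by (subst nonneg_infsum_complete) (auto simp: bij_betw_def intro!: SUP_upper)
    finally show "(\<Sum>i<n. f (?h i)) \<le> infsum f Y" .
  qed simp
  finally show ?thesis .
qed

text \<open>Removing the fixed prefix \<open>P\<close> costs a factor depending on \<open>P\<close>
  only. Replacing the supremum over a cylinder by \<Phi> costs \<epsilon> per letter, hence the
  exponent \<open>t + \<epsilon>\<close> in the mass.\<close>

lemma tail_mass_le_cover_sum:
  fixes t \<epsilon> K :: real
  assumes X: "shift_space p X" and cont: "continuous_on X \<phi>"
    and \<Phi>: "quasi_additive C B \<Phi>" and approx: "approximates_birkhoff X \<phi> \<epsilon> C \<Phi>"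
    and Y: "countable Y" "Y \<subseteq> language X"
  shows "tail_mass Y (\<lambda>z. exp (K - (t + \<epsilon>) * real (length z) + \<Phi> z)) P
    \<le> ennreal (exp (K + (t + \<epsilon>) * real (length P) - \<Phi> P + 2 * C)) *
      (\<Sum>\<^sub>\<infinity>w\<in>Y. ennreal (exp (- t * real (length w) + (SUP x\<in>cylinder w \<inter> X. birkhoff_sum \<phi> (length w) x))))"
proof -
  let ?A = "exp (K + (t + \<epsilon>) * real (length P) - \<Phi> P + 2 * C)"
  let ?s = "\<lambda>w. - t * real (length w) + (SUP x\<in>cylinder w \<inter> X. birkhoff_sum \<phi> (length w) x)"
  have "(if prefix P y then ennreal (exp (K - (t + \<epsilon>) * real (length (drop (length P) y)) + \<Phi> (drop (length P) y))) else 0)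
      \<le> ennreal ?A * ennreal (exp (?s y))" if "y \<in> Y" for y
  proof (cases "prefix P y")
    case True
    then obtain z where z: "y = P @ z" by (auto simp: prefix_def)
    have "cylinder y \<inter> X \<noteq> {}" using that Y(2) unfolding language_def by blast
    then obtain x where x: "x \<in> cylinder y" "x \<in> X" by blast
    obtain M where M: "M \<ge> 0" "\<forall>x\<in>X. \<bar>\<phi> x\<bar> \<le> M" using shift_space_bounded[OF X cont] .
    have "birkhoff_sum \<phi> (length y) x \<le> (SUP x\<in>cylinder y \<inter> X. birkhoff_sum \<phi> (length y) x)"
    proof (rule cSUP_upper)
      show "bdd_above (birkhoff_sum \<phi> (length y) ` (cylinder y \<inter> X))"
        using birkhoff_sum_bound[OF X M(2)] by (intro bdd_aboveI[of _ "M * real (length y)"]) (auto simp: abs_le_iff)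
    qed (use x in simp)
    moreover have "\<Phi> z \<le> \<Phi> y - \<Phi> P + C" using quasi_additive_append[OF \<Phi>, of P z] unfolding z by linarith
    moreover have "\<Phi> y \<le> birkhoff_sum \<phi> (length y) x + \<epsilon> * real (length y) + C"
      using approximates_birkhoffD[OF approx x] by linarith
    moreover have "(t + \<epsilon>) * real (length z) = (t + \<epsilon>) * real (length y) - (t + \<epsilon>) * real (length P)"
      unfolding z by (simp add: algebra_simps)
    ultimately have "K - (t + \<epsilon>) * real (length z) + \<Phi> z
        \<le> (K + (t + \<epsilon>) * real (length P) - \<Phi> P + 2 * C) + ?s y"
      by (simp add: algebra_simps)
    then have "exp (K - (t + \<epsilon>) * real (length z) + \<Phi> z) \<le> ?A * exp (?s y)"
      by (simp only: exp_add[symmetric] exp_le_cancel_iff)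
    moreover have "drop (length P) y = z" by (simp add: z)
    ultimately show ?thesis using True by (simp add: ennreal_leI flip: ennreal_mult)
  qed simp
  then have "tail_mass Y (\<lambda>z. exp (K - (t + \<epsilon>) * real (length z) + \<Phi> z)) P
      \<le> (\<integral>\<^sup>+y. ennreal ?A * ennreal (exp (?s y)) \<partial>count_space Y)"
    unfolding tail_mass_def by (intro nn_integral_mono) simp
  also have "\<dots> = ennreal ?A * (\<integral>\<^sup>+y. ennreal (exp (?s y)) \<partial>count_space Y)"
    by (intro nn_integral_cmult) simp
  also have "\<dots> \<le> ennreal ?A * (\<Sum>\<^sub>\<infinity>w\<in>Y. ennreal (exp (?s w)))"
    by (intro mult_left_mono nn_integral_le_infsum Y(1)) simp
  finally show ?thesis .
qed

lemma irregular_set_uminus: "irregular_set X (\<lambda>x. - f x) = irregular_set X f"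
  by (simp add: irregular_set_def birkhoff_sum_uminus convergent_minus_iff[symmetric])

text \<open>The strict inequality leaves \<open>t' - t\<close> per letter to pay for all errors. The
  constants are chosen without circularity: \<Phi> first, then \<delta> and \<theta>, then
  \<epsilon> and with it \<Psi>, then \<zeta>, and \<open>n\<close> last.\<close>

lemma pressure_sum_eq_0_if_irregular:
  fixes t t' :: real
  assumes p: "p \<ge> 1" and X: "shift_space p X" and \<phi>: "continuous_on X \<phi>" and \<psi>: "continuous_on X \<psi>"
    and G: "G \<subseteq> language X" and W_spec: "W_specification (language X) G"
    and approach: "edit_approachable p (language X) G"
    and nonempty: "irregular_set X \<psi> \<noteq> {}"
    and zero: "pressure_sum X (irregular_set X \<psi>) t \<phi> = 0" and "t < t'"
  shows "pressure_sum X X t' \<phi> = 0"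
proof (rule ccontr)
  assume pos: "pressure_sum X X t' \<phi> \<noteq> 0"
  define s where "s = t' - t"
  have s: "s > 0" using \<open>t < t'\<close> by (simp add: s_def)
  obtain C B \<Phi> where \<Phi>: "quasi_additive C B \<Phi>" "approximates_birkhoff X \<phi> (s / 8) C \<Phi>"
    using ex_quasi_additive_approximation[OF X \<phi>, of "s / 8"] s by auto
  obtain c where c: "c > 0" and growth: "\<forall>\<^sub>F n in sequentially.
      c * exp ((t' - s / 8) * real n) \<le> (\<Sum>w\<in>{w \<in> language X. length w = n}. exp (\<Phi> w))"
    using language_sum_growth[OF X \<Phi>(2) pos] by blast
  define t1 where "t1 = t + s / 8"
  define H where "H = \<bar>t1\<bar> + B"
  have H: "H \<ge> 0" using quasi_additive_nonneg[OF \<Phi>(1)] by (simp add: H_def)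
  \<comment> \<open>This is the length of the filler in proportion to \<open>n\<close>. The filler
    has at most \<open>2 * \<delta> * n + 2\<close> letters at cost \<open>H\<close> each.\<close>
  define \<delta> where "\<delta> = min (1 / 2) (s / (32 * (H + 1)))"
  have \<delta>: "\<delta> > 0" "\<delta> \<le> 1 / 2" "2 * H * \<delta> \<le> s / 16"
  proof -
    have le: "\<delta> \<le> 1 / 2" "\<delta> \<le> s / (32 * (H + 1))"
      unfolding \<delta>_def by (rule min.cobounded1, rule min.cobounded2)
    show "\<delta> > 0" using s H by (simp add: \<delta>_def)
    show "\<delta> \<le> 1 / 2" by (rule le(1))
    have "H * \<delta> \<le> (H + 1) * (s / (32 * (H + 1)))"
      using le(2) \<open>\<delta> > 0\<close> H by (intro mult_mono) simp_all
    also have "\<dots> = s / 32" using H by (auto simp: divide_simps)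
    finally show "2 * H * \<delta> \<le> s / 16" by simp
  qed
  \<comment> \<open>The bound by \<open>s / 8\<close> covers both the discrepancy between
    \<open>m\<close> and \<open>n\<close>, at rate \<open>\<bar>t1\<bar>\<close>, and the loss
    \<theta> in the weight of \<open>W\<close>.\<close>
  define \<theta> where "\<theta> = min (1 / 2) (s / (8 * (\<bar>t1\<bar> + 1)))"
  have \<theta>: "\<theta> > 0" "\<theta> \<le> 1 / 2" "(\<bar>t1\<bar> + 1) * \<theta> \<le> s / 8"
  proof -
    have le: "\<theta> \<le> 1 / 2" "\<theta> \<le> s / (8 * (\<bar>t1\<bar> + 1))"
      unfolding \<theta>_def by (rule min.cobounded1, rule min.cobounded2)
    show "\<theta> > 0" using s by (simp add: \<theta>_def add_nonneg_pos)
    show "\<theta> \<le> 1 / 2" by (rule le(1))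
    have "(\<bar>t1\<bar> + 1) * \<theta> \<le> (\<bar>t1\<bar> + 1) * (s / (8 * (\<bar>t1\<bar> + 1)))"
      using le(2) by (rule mult_left_mono) simp
    also have "\<dots> = s / 8" by (auto simp: divide_simps)
    finally show "(\<bar>t1\<bar> + 1) * \<theta> \<le> s / 8" .
  qed
  obtain x0 where x0: "x0 \<in> irregular_set X \<psi>" using nonempty by blast
  obtain \<alpha> \<beta> where \<alpha>\<beta>: "\<alpha> < \<beta>" and above: "\<And>l. \<exists>y\<in>X. birkhoff_sum \<psi> l y \<ge> \<beta> * real l"
    and below: "\<And>l. \<exists>y\<in>X. birkhoff_sum \<psi> l y \<le> \<alpha> * real l"
    using irregular_imp_blocks[OF X \<psi> x0] by metis
  define \<rho> where "\<rho> = \<beta> - \<alpha>"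
  have \<rho>: "\<rho> > 0" using \<alpha>\<beta> by (simp add: \<rho>_def)
  \<comment> \<open>The filler will move the recentred \<Psi> by at least
    \<open>\<rho> / 4 * (\<delta> * n)\<close>, which is \<open>500 * \<epsilon> * n\<close>; the
    competing errors turn out smaller.\<close>
  define \<epsilon> where "\<epsilon> = \<rho> * \<delta> / 2000"
  have \<epsilon>: "\<epsilon> > 0" "\<epsilon> \<le> \<rho> / 8"
  proof -
    show "\<epsilon> > 0" using \<rho> \<delta> by (simp add: \<epsilon>_def)
    have "\<rho> * \<delta> \<le> \<rho> * 1" using \<rho> \<delta> by (intro mult_left_mono) auto
    then show "\<epsilon> \<le> \<rho> / 8" using \<rho> by (simp add: \<epsilon>_def)
  qed
  obtain C' B' \<Psi> where \<Psi>: "quasi_additive C' B' \<Psi>" "approximates_birkhoff X \<psi> \<epsilon> C' \<Psi>"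
    using ex_quasi_additive_approximation[OF X \<psi> \<epsilon>(1)] by auto
  have C'B': "C' \<ge> 0" "B' \<ge> 0" using quasi_additive_nonneg[OF \<Psi>(1)] by auto
  define \<zeta> where "\<zeta> = min 1 (\<rho> / (8 * (1 + B')))"
  have \<zeta>: "\<zeta> > 0" "\<zeta> \<le> 1" "(1 + B') * \<zeta> \<le> \<rho> / 8"
  proof -
    have le: "\<zeta> \<le> 1" "\<zeta> \<le> \<rho> / (8 * (1 + B'))"
      unfolding \<zeta>_def by (rule min.cobounded1, rule min.cobounded2)
    show "\<zeta> > 0" using \<rho> C'B' by (simp add: \<zeta>_def add_pos_nonneg)
    show "\<zeta> \<le> 1" by (rule le(1))
    have "(1 + B') * \<zeta> \<le> (1 + B') * (\<rho> / (8 * (1 + B')))"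
      using le(2) by (rule mult_left_mono) (use C'B' in simp)
    also have "\<dots> = \<rho> / 8" using C'B' by (auto simp: divide_simps)
    finally show "(1 + B') * \<zeta> \<le> \<rho> / 8" .
  qed
  obtain \<tau> where spec: "\<And>v w. v \<in> G \<Longrightarrow> w \<in> G \<Longrightarrow> \<exists>u. length u \<le> \<tau> \<and> v @ u @ w \<in> G"
    using W_spec unfolding W_specification_def by blast
  define l where "l n = nat \<lceil>\<delta> * real n\<rceil>" for n
  have l: "\<delta> * real n \<le> real (l n)" "real (l n) \<le> \<delta> * real n + 1" for n
  proof -
    have "0 \<le> \<delta> * real n" using \<delta> by simp
    then show "\<delta> * real n \<le> real (l n)" "real (l n) \<le> \<delta> * real n + 1"
      unfolding l_def by linarith+
  qed
  have l_top: "filterlim l sequentially sequentially"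
    unfolding l_def using \<delta>(1) by real_asymp
  have below': "\<exists>y\<in>X. birkhoff_sum (\<lambda>x. - \<psi> x) l y \<ge> (- \<alpha>) * real l" for l
    using below[of l] by (simp add: birkhoff_sum_uminus)
  have "\<exists>n>0. (\<exists>m W \<gamma>. finite W \<and> W \<noteq> {} \<and> W \<subseteq> G \<and>
      (\<forall>w\<in>W. length w = m \<and> \<bar>\<Psi> w - \<gamma> * real m\<bar> \<le> \<epsilon> * real n) \<and> \<bar>\<gamma>\<bar> \<le> B' \<and>
      \<bar>real m - real n\<bar> \<le> \<theta> * real n \<and> exp ((t' - s / 8 - \<theta>) * real n) \<le> (\<Sum>w\<in>W. exp (\<Phi> w))) \<and>
    (\<exists>v\<in>G. \<bar>real (length v) - real (l n)\<bar> \<le> \<zeta> * real (l n) \<and> (\<beta> - \<epsilon> - \<zeta>) * real (l n) \<le> \<Psi> v) \<and>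
    (\<exists>v\<in>G. \<bar>real (length v) - real (l n)\<bar> \<le> \<zeta> * real (l n) \<and> (- \<alpha> - \<epsilon> - \<zeta>) * real (l n) \<le> - \<Psi> v) \<and>
    ln (real (2 * \<tau> + 1)) + 2 * C + H * (2 * real \<tau> + 2) \<le> s / 4 * real n \<and>
    4 * B' * real \<tau> + 4 * C' \<le> 2 * \<epsilon> * real n \<and> 2 * real \<tau> + 2 \<le> real n / 2"
  proof -
    have linear: "\<forall>\<^sub>F n in sequentially. a \<le> b * real n" if "b > 0" for a b :: real
      using that by real_asymp
    have "\<forall>\<^sub>F n in sequentially. ln (real (2 * \<tau> + 1)) + 2 * C + H * (2 * real \<tau> + 2) \<le> s / 4 * real n"
      using s by (intro linear) simp
    moreover have "\<forall>\<^sub>F n in sequentially. 4 * B' * real \<tau> + 4 * C' \<le> 2 * \<epsilon> * real n"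
      using \<epsilon> by (intro linear) simp
    moreover have "\<forall>\<^sub>F n in sequentially. 2 * real \<tau> + 2 \<le> 1 / 2 * real n" by (intro linear) simp
    moreover note eventually_gt_at_top[of "0::nat"]
      eventually_ex_uniform_words[OF X p G approach \<Phi>(1) \<Psi>(1) \<theta>(1) \<epsilon>(1) c growth]
      eventually_compose_filterlim[OF eventually_ex_filler[OF X G approach \<Psi> above \<zeta>(1)] l_top]
      eventually_compose_filterlim[OF eventually_ex_filler[OF X G approach quasi_additive_uminus[OF \<Psi>(1)]
        approximates_birkhoff_uminus[OF \<Psi>(2)] below' \<zeta>(1)] l_top]
    ultimately have "\<forall>\<^sub>F n in sequentially. n > 0 \<and> (\<exists>m W \<gamma>. finite W \<and> W \<noteq> {} \<and> W \<subseteq> G \<and>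
        (\<forall>w\<in>W. length w = m \<and> \<bar>\<Psi> w - \<gamma> * real m\<bar> \<le> \<epsilon> * real n) \<and> \<bar>\<gamma>\<bar> \<le> B' \<and>
        \<bar>real m - real n\<bar> \<le> \<theta> * real n \<and> exp ((t' - s / 8 - \<theta>) * real n) \<le> (\<Sum>w\<in>W. exp (\<Phi> w))) \<and>
      (\<exists>v\<in>G. \<bar>real (length v) - real (l n)\<bar> \<le> \<zeta> * real (l n) \<and> (\<beta> - \<epsilon> - \<zeta>) * real (l n) \<le> \<Psi> v) \<and>
      (\<exists>v\<in>G. \<bar>real (length v) - real (l n)\<bar> \<le> \<zeta> * real (l n) \<and> (- \<alpha> - \<epsilon> - \<zeta>) * real (l n) \<le> - \<Psi> v) \<and>
      ln (real (2 * \<tau> + 1)) + 2 * C + H * (2 * real \<tau> + 2) \<le> s / 4 * real n \<and>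
      4 * B' * real \<tau> + 4 * C' \<le> 2 * \<epsilon> * real n \<and> 2 * real \<tau> + 2 \<le> real n / 2"
      by eventually_elim (intro conjI; (assumption | simp))
    from eventually_happens'[OF sequentially_bot this] show ?thesis .
  qed
  then obtain n m W \<gamma> v1 v2 where n: "n > 0"
    and W: "finite W" "W \<noteq> {}" "W \<subseteq> G" "\<And>w. w \<in> W \<Longrightarrow> length w = m"
      "\<And>w. w \<in> W \<Longrightarrow> \<bar>\<Psi> w - \<gamma> * real m\<bar> \<le> \<epsilon> * real n" "\<bar>\<gamma>\<bar> \<le> B'"
    and m: "\<bar>real m - real n\<bar> \<le> \<theta> * real n"
    and sumW: "exp ((t' - s / 8 - \<theta>) * real n) \<le> (\<Sum>w\<in>W. exp (\<Phi> w))"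
    and v1: "v1 \<in> G" "\<bar>real (length v1) - real (l n)\<bar> \<le> \<zeta> * real (l n)" "(\<beta> - \<epsilon> - \<zeta>) * real (l n) \<le> \<Psi> v1"
    and v2: "v2 \<in> G" "\<bar>real (length v2) - real (l n)\<bar> \<le> \<zeta> * real (l n)" "(- \<alpha> - \<epsilon> - \<zeta>) * real (l n) \<le> - \<Psi> v2"
    and n1: "ln (real (2 * \<tau> + 1)) + 2 * C + H * (2 * real \<tau> + 2) \<le> s / 4 * real n"
    and n2: "4 * B' * real \<tau> + 4 * C' \<le> 2 * \<epsilon> * real n" and n3: "2 * real \<tau> + 2 \<le> real n / 2"
    by blast
  have "\<theta> * real n \<le> 1 / 2 * real n" using \<theta>(2) by (intro mult_right_mono) auto
  then have m': "real n / 2 \<le> real m" "real m \<le> 3 / 2 * real n" using m by linarith+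

  \<comment> \<open>Stated for general \<open>f\<close>, \<open>F\<close>, \<open>g\<close> and
    \<open>b\<close>, so that it serves both for \<psi> with a high filler and for its negative with
    a low one. The filler \<open>v\<close> is also the starting word.\<close>
  have contradiction: False
    if f: "irregular_set X f = irregular_set X \<psi>" "quasi_additive C' B' F" "approximates_birkhoff X f \<epsilon> C' F"
      and FW: "\<And>w. w \<in> W \<Longrightarrow> \<bar>F w - g * real m\<bar> \<le> \<epsilon> * real n" and g: "\<bar>g\<bar> \<le> B'" "g \<le> b - \<rho> / 2"
      and v: "v \<in> G" "\<bar>real (length v) - real (l n)\<bar> \<le> \<zeta> * real (l n)" "(b - \<epsilon> - \<zeta>) * real (l n) \<le> F v"
    for f F g b v
  proof -
    have up: "500 * \<epsilon> * real n \<le> F v - g * real (length v)"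
    proof -
      have "\<bar>g * (real (length v) - real (l n))\<bar> \<le> B' * (\<zeta> * real (l n))"
        unfolding abs_mult using g v(2) C'B' by (intro mult_mono) auto
      then have "g * real (length v) \<le> (g + B' * \<zeta>) * real (l n)" by (simp add: algebra_simps abs_le_iff)
      then have "(b - \<epsilon> - \<zeta> - g - B' * \<zeta>) * real (l n) \<le> F v - g * real (length v)"
        using v(3) by (simp add: algebra_simps)
      \<comment> \<open>Of the distance \<open>\<rho> / 2\<close> between \<open>g\<close> and
        \<open>b\<close>, the approximation takes \<open>\<rho> / 8\<close> and the inexact filler
        another \<open>\<rho> / 8\<close>.\<close>
      moreover have "\<rho> / 4 \<le> b - \<epsilon> - \<zeta> - g - B' * \<zeta>"
        using g(2) \<epsilon>(2) \<zeta>(3) by (simp add: algebra_simps)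
      then have "\<rho> / 4 * (\<delta> * real n) \<le> (b - \<epsilon> - \<zeta> - g - B' * \<zeta>) * real (l n)"
        using l(1)[of n] \<rho> \<delta>(1) by (intro mult_mono) auto
      moreover have "500 * \<epsilon> * real n = \<rho> / 4 * (\<delta> * real n)" by (simp add: \<epsilon>_def)
      ultimately show ?thesis by linarith
    qed
    have len_v: "real (length v) \<le> 2 * \<delta> * real n + 2"
    proof -
      have "\<zeta> * real (l n) \<le> 1 * real (l n)" using \<zeta>(2) by (intro mult_right_mono) auto
      then show ?thesis using v(2) l(2)[of n] by linarith
    qed
    have large: "real (2 * \<tau> + 1) * exp (t1 * real m + 2 * C + (\<bar>t1\<bar> + B) * real (2 * \<tau> + length v))
        \<le> (\<Sum>w\<in>W. exp (\<Phi> w))"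
    proof -
      have "\<bar>t1 * (real m - real n)\<bar> \<le> \<bar>t1\<bar> * (\<theta> * real n)"
        unfolding abs_mult using m by (rule mult_left_mono) simp
      then have "t1 * (real m - real n) \<le> \<bar>t1\<bar> * (\<theta> * real n)" by linarith
      also have "\<dots> \<le> (s / 8 - \<theta>) * real n"
        using mult_right_mono[OF \<theta>(3), of "real n"] by (simp add: algebra_simps)
      finally have 1: "t1 * real m \<le> t1 * real n + (s / 8 - \<theta>) * real n" by (simp add: algebra_simps)
      have "H * real (2 * \<tau> + length v) \<le> H * (2 * real \<tau> + 2 + 2 * \<delta> * real n)"
        using len_v H by (intro mult_left_mono) auto
      also have "\<dots> = H * (2 * real \<tau> + 2) + (2 * H * \<delta>) * real n" by (simp add: algebra_simps)
      also have "\<dots> \<le> H * (2 * real \<tau> + 2) + s / 16 * real n"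
        using \<delta>(3) by (intro add_left_mono mult_right_mono) auto
      finally have 2: "H * real (2 * \<tau> + length v) \<le> H * (2 * real \<tau> + 2) + s / 16 * real n" .
      have "0 \<le> s * real n" using s by simp
      \<comment> \<open>Per letter, \<open>s / 8\<close> goes to \<open>t1\<close>,
        \<open>s / 8\<close> to \<theta>, \<open>s / 16\<close> to the filler and
        \<open>s / 4\<close> to the constants. Together this is 9/16 of \<open>s\<close>, within the
        available 7/8.\<close>
      then have "ln (real (2 * \<tau> + 1)) + (t1 * real m + 2 * C + H * real (2 * \<tau> + length v))
          \<le> (t' - s / 8 - \<theta>) * real n"
        using 1 2 n1 by (simp add: t1_def s_def field_simps)
      then have "exp (ln (real (2 * \<tau> + 1)) + (t1 * real m + 2 * C + H * real (2 * \<tau> + length v)))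
          \<le> exp ((t' - s / 8 - \<theta>) * real n)" by simp
      then show ?thesis using sumW by (simp add: exp_add H_def)
    qed
    define K where "K = H * real (2 * \<tau> + length v + m)"
    \<comment> \<open>This bounds the logarithm of the factor between the cover sum and the initial
      mass at \<open>v\<close>. The cover is taken cheaper than \<open>exp (- A)\<close>, and by
      words longer than \<open>v\<close>, the starting word.\<close>
    define A where "A = K + (t + s / 8) * real (length v) - \<Phi> v + 2 * C"
    obtain Y where Y: "Y \<in> cylinder_covers X (irregular_set X \<psi>) (length v)"
      and small: "(\<Sum>\<^sub>\<infinity>w\<in>Y. ennreal (exp (- t * real (length w)
        + (SUP x\<in>cylinder w \<inter> X. birkhoff_sum \<phi> (length w) x)))) < ennreal (exp (- A))"
      using pressure_sum_zero_imp_cover[OF zero, of "ennreal (exp (- A))" "length v"] by auto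
    have Y': "countable Y" "Y \<subseteq> language X" using Y by (auto simp: cylinder_covers_def)
    have "tail_mass Y (\<lambda>z. exp (K - (t + s / 8) * real (length z) + \<Phi> z)) v
        \<le> ennreal (exp A) * (\<Sum>\<^sub>\<infinity>w\<in>Y. ennreal (exp (- t * real (length w)
            + (SUP x\<in>cylinder w \<inter> X. birkhoff_sum \<phi> (length w) x))))"
      unfolding A_def by (rule tail_mass_le_cover_sum[OF X \<phi> \<Phi> Y'])
    also have "\<dots> < ennreal (exp A) * ennreal (exp (- A))"
      using small by (intro ennreal_mult_strict_left_mono) auto
    also have "\<dots> = 1" by (simp flip: ennreal_mult exp_add)
    finally have less: "tail_mass Y (\<lambda>z. exp (K - t1 * real (length z) + \<Phi> z)) v < 1" by (simp add: t1_def)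
    have "\<exists>x\<in>irregular_set X f. \<forall>y\<in>Y. x \<notin> cylinder y"
    proof (rule ex_irregular_point_avoiding[OF X G spec \<Phi>(1) f(2,3) \<epsilon>(1) W(1-4) FW g(1) v(1) v(1) large _ _ _ _ _ _ _ less])
      show "(\<bar>t1\<bar> + B) * real (2 * \<tau> + length v + m) \<le> K" by (simp add: K_def H_def)
      show "\<epsilon> * real n + 2 * B' * real \<tau> + 2 * C' \<le> 2 * \<epsilon> * real n" using n2 by simp
      \<comment> \<open>Out of 500, one unit goes to the spread within \<open>W\<close> and two to
        the constants bounded in \<open>n2\<close>.\<close>
      show "497 * \<epsilon> * real n + \<epsilon> * real n + 4 * B' * real \<tau> + 4 * C' \<le> F v - g * real (length v)"
        using up n2 by simp
      show "0 < real n / 2" using n by simp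
      show "real n / 2 \<le> real m" by (rule m'(1))
      have "2 * \<delta> * real n \<le> 1 * real n" using \<delta>(2) by (intro mult_right_mono) auto
      then show "real (2 * \<tau> + length v + m) \<le> 4 * real n"
        using len_v m'(2) n3 unfolding of_nat_add of_nat_mult of_nat_numeral by linarith
      \<comment> \<open>In units of \<open>\<epsilon> * n\<close> the left side is 48 + 8 * (2 + 48)
        = 448.\<close>
      show "12 * \<epsilon> * (4 * real n) + 4 * real n / (real n / 2) * (2 * \<epsilon> * real n + 12 * \<epsilon> * (4 * real n))
          < 497 * \<epsilon> * real n"
        using n \<epsilon>(1) by simp
      show "length v \<le> length y" if "y \<in> Y" for y using Y that by (auto simp: cylinder_covers_def less_imp_le)
    qed
    then show False using Y unfolding f(1) cylinder_covers_def by blast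
  qed
  show False
  \<comment> \<open>The threshold is the midpoint of \<alpha> and \<beta>, so one of the two fillers
    is at distance at least \<open>\<rho> / 2\<close> from \<gamma>.\<close>
  proof (cases "\<gamma> \<le> \<beta> - \<rho> / 2")
    case True
    show ?thesis by (rule contradiction[OF refl \<Psi> W(5,6) True v1])
  next
    case False
    show ?thesis
    proof (rule contradiction[OF irregular_set_uminus quasi_additive_uminus[OF \<Psi>(1)]
          approximates_birkhoff_uminus[OF \<Psi>(2)] _ _ _ v2])
      show "\<bar>- \<Psi> w - (- \<gamma>) * real m\<bar> \<le> \<epsilon> * real n" if "w \<in> W" for w using W(5)[OF that] by simp
      show "\<bar>- \<gamma>\<bar> \<le> B'" using W(6) by simp
      show "- \<gamma> \<le> - \<alpha> - \<rho> / 2" using False by (simp add: \<rho>_def field_simps)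
    qed
  qed
qed

theorem theorem1p3:
  fixes p :: nat
    and X :: "(nat \<Rightarrow> nat) set"
    and G :: "nat list set"
    and \<phi> \<psi> :: "(nat \<Rightarrow> nat) \<Rightarrow> real"
  assumes "p \<ge> 2"
    and "shift_space p X"
    and "continuous_on X \<phi>"
    and "G \<subseteq> language X"
    and "W_specification (language X) G"
    and "edit_approachable p (language X) G"
    and "continuous_on X \<psi>"
  shows "irregular_set X \<psi> = {} \<or> pressure X (irregular_set X \<psi>) \<phi> = pressure X X \<phi>"
proof (cases "irregular_set X \<psi> = {}")
  case False
  have "pressure X X \<phi> \<le> pressure X (irregular_set X \<psi>) \<phi>"
    unfolding pressure_def[of X "irregular_set X \<psi>"]
  proof (rule Inf_greatest)
    fix u assume "u \<in> {ereal t | t. pressure_sum X (irregular_set X \<psi>) t \<phi> = 0}"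
    then obtain t where t: "u = ereal t" "pressure_sum X (irregular_set X \<psi>) t \<phi> = 0" by blast
    \<comment> \<open>The detour through \<open>t + e\<close> is due to the strict inequality
      between the two exponents in the preceding lemma.\<close>
    have "pressure X X \<phi> \<le> ereal t + ereal e" if "e > 0" for e
    proof -
      have "pressure_sum X X (t + e) \<phi> = 0"
        by (rule pressure_sum_eq_0_if_irregular[OF _ assms(2,3,7,4-6) False t(2)]) (use assms(1) that in auto)
      then have "pressure X X \<phi> \<le> ereal (t + e)"
        unfolding pressure_def by (intro Inf_lower) blast
      then show ?thesis by simp
    qed
    then show "pressure X X \<phi> \<le> u" unfolding t(1) by (rule ereal_le_epsilon2)
  qed
  moreover have "pressure X (irregular_set X \<psi>) \<phi> \<le> pressure X X \<phi>"
    by (intro pressure_mono) (auto simp: irregular_set_def)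
  ultimately show ?thesis by simp
qed simp

end
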